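(* Let $n\ge 1$ be an integer. Let $N$ be the eigenvalue counting function of the Laplacian on the round sphere $\mathbb{S}^n$ and let $w$ be the Weyl function of $\mathbb{S}^n$. Then $N$ crosses $w$ infinitely many times. Consequently Pólya's eigenvalue conjecture does not hold for $\mathbb{S}^n$: neither the inequality $N(x)<w(x)$ for all $x>0$, nor the inequality $N(x)>w(x)$ for all $x>0$, is true.
   Context: $\mathbb{S}^n=\{x\in\mathbb{R}^{n+1} : |x|=1\}$ carries the Riemannian metric induced by the Euclidean metric on $\mathbb{R}^{n+1}$. The Laplacian is $-\operatorname{div}\operatorname{grad}$; its eigenvalues, listed with multiplicity, are $\lambda_1\le\lambda_2\le\cdots$ (including the eigenvalue $0$). The eigenvalue counting function is $N(x)=\#\{k : \lambda_k\le x\}$. The Weyl function of a compact $n$-dimensional Riemannian manifold $M$ of volume $|M|$ is $w(x)=\frac{\omega_n}{(2\pi)^n}|M|\,x^{n/2}$ for $x\ge 0$, where $\omega_n$ is the volume of the unit ball in $\mathbb{R}^n$. "$N$ crosses $w$ infinitely many times" means that $N-w$ changes sign infinitely often: there is a sequence $0<x_1<x_2<x_3<\cdots$ tending to infinity such that $N(x_i)-w(x_i)$ is nonzero for every $i$ and has alternating signs. Pólya's conjecture for domains in $\mathbb{R}^n$ (Dirichlet eigenvalues) is $N<w$; the analogue considered for closed manifolds is $N<w$ or $N>w$, depending on the sign of the scalar curvature. *)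

theory Defs
  imports "HOL-Analysis.Analysis" "HOL-Library.Function_Algebras"
begin

section \<open>Real-valued functions as a real vector space\<close>

interpretation fun_space: vector_space "\<lambda>(c::real) (f::'a \<Rightarrow> real) x. c * f x"
  by unfold_locales (auto simp: fun_eq_iff algebra_simps)


section \<open>Calculus on the unit sphere with the induced metric\<close>

definition tangent_proj :: "'a::euclidean_space \<Rightarrow> 'a \<Rightarrow> 'a" where
  "tangent_proj x v = v - (v \<bullet> x) *\<^sub>R x"

definition tangent_space :: "'a::euclidean_space \<Rightarrow> 'a set" where
  "tangent_space x = {v. v \<bullet> x = 0}"

text \<open>
  The derivative within the sphere is determined only on the tangent space; its value in the
  normal direction is arbitrary. All definitions below use it on tangent vectors only.
\<close>

abbreviation sphere_deriv ::
    "('a::euclidean_space \<Rightarrow> 'b::real_normed_vector) \<Rightarrow> 'a \<Rightarrow> 'a \<Rightarrow> 'b" where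
  "sphere_deriv f x \<equiv> frechet_derivative f (at x within sphere 0 1)"

definition sphere_grad :: "('a::euclidean_space \<Rightarrow> real) \<Rightarrow> 'a \<Rightarrow> 'a" where
  "sphere_grad f x =
     (THE g. g \<in> tangent_space x \<and> (\<forall>v\<in>tangent_space x. g \<bullet> v = sphere_deriv f x v))"

text \<open>
  The Levi-Civita connection of the induced metric is the tangential part of the ambient
  derivative.
\<close>

definition covariant_deriv :: "('a::euclidean_space \<Rightarrow> 'a) \<Rightarrow> 'a \<Rightarrow> 'a \<Rightarrow> 'a" where
  "covariant_deriv X x v = tangent_proj x (sphere_deriv X x v)"

text \<open>
  The divergence is the trace of \<open>v \<mapsto> covariant_deriv X x v\<close> on the tangent space, computed as
  the trace over the ambient space of its composition with the orthogonal projection.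
\<close>

definition sphere_div :: "('a::euclidean_space \<Rightarrow> 'a) \<Rightarrow> 'a \<Rightarrow> real" where
  "sphere_div X x = (\<Sum>b\<in>Basis. covariant_deriv X x (tangent_proj x b) \<bullet> b)"

definition sphere_laplacian :: "('a::euclidean_space \<Rightarrow> real) \<Rightarrow> 'a \<Rightarrow> real" where
  "sphere_laplacian f x = - sphere_div (sphere_grad f) x"

primrec sphere_Ck :: "nat \<Rightarrow> ('a::euclidean_space \<Rightarrow> real) \<Rightarrow> bool" where
  "sphere_Ck 0 f \<longleftrightarrow> continuous_on (sphere 0 1) f"
| "sphere_Ck (Suc k) f \<longleftrightarrow>
     f differentiable_on sphere 0 1 \<and> (\<forall>b\<in>Basis. sphere_Ck k (\<lambda>x. sphere_grad f x \<bullet> b))"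

definition sphere_smooth :: "('a::euclidean_space \<Rightarrow> real) \<Rightarrow> bool" where
  "sphere_smooth f \<longleftrightarrow> (\<forall>k. sphere_Ck k f)"


section \<open>Spectrum and eigenvalue counting function\<close>

text \<open>
  Functions on the sphere are represented by functions on the ambient space that vanish off
  the sphere, so that distinct elements are distinct functions on the sphere.
\<close>

definition eigenspace :: "real \<Rightarrow> ('a::euclidean_space \<Rightarrow> real) set" where
  "eigenspace \<mu> =
     {f. sphere_smooth f \<and> (\<forall>x. x \<notin> sphere 0 1 \<longrightarrow> f x = 0) \<and>
         (\<forall>x\<in>sphere 0 1. sphere_laplacian f x = \<mu> * f x)}"

text \<open>Unlike \<open>fun_space.dim\<close>, this does not assign dimension 0 to infinite-dimensional spaces.\<close>

definition has_dimension :: "('a \<Rightarrow> real) set \<Rightarrow> nat \<Rightarrow> bool" where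
  "has_dimension V m \<longleftrightarrow>
     (\<exists>B. finite B \<and> card B = m \<and> fun_space.independent B \<and> fun_space.span B = V)"

text \<open>
  The unit sphere of dimension \<open>n = CARD('n)\<close> lies in \<open>(real ^ 'n) \<times> real\<close>, which carries the
  Euclidean inner product of the \<open>(n + 1)\<close>-dimensional space.
\<close>

type_synonym 'n ambient = "(real ^ 'n) \<times> real"

definition lists_eigenvalues :: "'n::finite itself \<Rightarrow> (nat \<Rightarrow> real) \<Rightarrow> bool" where
  "lists_eigenvalues T ev \<longleftrightarrow>
     mono ev \<and>
     (\<forall>\<mu>. finite {k. ev k = \<mu>} \<and>
          has_dimension (eigenspace \<mu> :: ('n ambient \<Rightarrow> real) set) (card {k. ev k = \<mu>}))"

definition sphere_eigenvalue :: "'n::finite itself \<Rightarrow> nat \<Rightarrow> real" where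
  "sphere_eigenvalue T = (SOME ev. lists_eigenvalues T ev)"

definition sphere_counting :: "'n::finite itself \<Rightarrow> real \<Rightarrow> real" where
  "sphere_counting T x = real (card {k. sphere_eigenvalue T k \<le> x})"


section \<open>Riemannian volume and Weyl function\<close>

text \<open>Inverse of the stereographic projection from the north pole \<open>(0, 1)\<close>.\<close>

definition stereo :: "real ^ 'n::finite \<Rightarrow> 'n ambient" where
  "stereo u = (1 / (1 + (norm u)\<^sup>2)) *\<^sub>R (2 *\<^sub>R u, (norm u)\<^sup>2 - 1)"

lemma stereo_mem: "stereo u \<in> sphere 0 1 - {(0, 1)}"
proof -
  have p: "1 + (norm u)\<^sup>2 > 0" by (simp add: add_pos_nonneg)
  define s where "s = (norm u)\<^sup>2"
  have s: "1 + s > 0" using p by (simp add: s_def)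
  have "(norm (stereo u))\<^sup>2 = (1 / (1 + s))\<^sup>2 * (4 * s + (s - 1)\<^sup>2)"
    by (simp add: stereo_def norm_Pair power_mult_distrib s_def power_divide add_divide_distrib)
  also have "4 * s + (s - 1)\<^sup>2 = (1 + s)\<^sup>2"
    by (simp add: power2_eq_square algebra_simps)
  also have "(1 / (1 + s))\<^sup>2 * (1 + s)\<^sup>2 = 1"
    using s by (simp add: power_divide)
  finally have "norm (stereo u) = 1"
    by (simp add: power2_eq_1_iff) (smt (verit) norm_ge_zero)
  moreover have "snd (stereo u) \<noteq> 1"
    using s by (simp add: stereo_def s_def[symmetric])
  ultimately show ?thesis by auto
qed

lemma inj_stereo: "inj (stereo :: real ^ 'n::finite \<Rightarrow> _)"
proof (rule inj_on_inverseI[where g = "\<lambda>p. (1 / (1 - snd p)) *\<^sub>R fst p"])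
  fix u :: "real ^ 'n"
  define s where "s = (norm u)\<^sup>2"
  have s: "1 + s > 0" by (simp add: s_def add_pos_nonneg)
  have "1 - snd (stereo u) = 2 / (1 + s)"
    using s by (simp add: stereo_def s_def[symmetric] divide_simps)
  moreover have "fst (stereo u) = (2 / (1 + s)) *\<^sub>R u"
    by (simp add: stereo_def s_def[symmetric])
  moreover have "1 / (2 / (1 + s)) * (2 / (1 + s)) = 1"
    using s by simp
  ultimately show "(1 / (1 - snd (stereo u))) *\<^sub>R fst (stereo u) = u"
    by (simp only: scaleR_scaleR scaleR_one)
qed

lemma stereo_surj:
  assumes "p \<in> sphere 0 1 - {(0, 1)}"
  shows "p \<in> range (stereo :: real ^ 'n::finite \<Rightarrow> _)"
proof -
  obtain y t where p: "p = (y, t)" by fastforce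
  have e: "(norm y)\<^sup>2 = 1 - t\<^sup>2"
    using assms by (simp add: p norm_Pair)
  have t: "1 - t \<noteq> 0" using assms e by (auto simp: p)
  define u where "u = (1 / (1 - t)) *\<^sub>R y"
  have "(norm u)\<^sup>2 = (1 - t\<^sup>2) / (1 - t)\<^sup>2"
    using e by (simp add: u_def power_divide)
  also have "1 - t\<^sup>2 = (1 + t) * (1 - t)" by (simp add: power2_eq_square algebra_simps)
  also have "\<dots> / (1 - t)\<^sup>2 = (1 + t) / (1 - t)" using t by (simp add: power2_eq_square)
  finally have s: "(norm u)\<^sup>2 = (1 + t) / (1 - t)" .
  have a: "1 + (norm u)\<^sup>2 = 2 / (1 - t)" and b: "(norm u)\<^sup>2 - 1 = 2 * t / (1 - t)"
    using t by (simp_all add: s divide_simps)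
  have "(1 / (2 / (1 - t))) * (2 * (1 / (1 - t))) = 1" "(1 / (2 / (1 - t))) * (2 * t / (1 - t)) = t"
    using t by simp_all
  then have "stereo u = (y, t)"
    unfolding stereo_def a b unfolding u_def by (simp only: scaleR_Pair scaleR_scaleR real_scaleR_def scaleR_one mult.assoc)
  then show ?thesis by (metis p rangeI)
qed

lemma range_stereo: "range stereo = sphere 0 1 - {(0, 1)}"
proof
  show "range stereo \<subseteq> sphere 0 1 - {(0, 1)}" by (rule image_subsetI) (rule stereo_mem)
  show "sphere 0 1 - {(0, 1)} \<subseteq> range stereo" by (rule subsetI) (rule stereo_surj)
qed

text \<open>Matrix of the induced metric in the coordinates given by \<open>stereo\<close>.\<close>

definition stereo_metric :: "real ^ 'n::finite \<Rightarrow> real ^ 'n ^ 'n" where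
  "stereo_metric u =
     (\<chi> i j. frechet_derivative stereo (at u) (axis i 1) \<bullet>
             frechet_derivative stereo (at u) (axis j 1))"

text \<open>The chart misses a single point, which does not contribute to the volume.\<close>

definition sphere_volume :: "'n::finite itself \<Rightarrow> real" where
  "sphere_volume T = (\<integral>u. sqrt (det (stereo_metric (u :: real ^ 'n))) \<partial>lborel)"

definition weyl :: "'n::finite itself \<Rightarrow> real \<Rightarrow> real" where
  "weyl T x =
     measure lborel (ball (0 :: real ^ 'n) 1) / (2 * pi) ^ CARD('n) *
     sphere_volume T * x powr (real CARD('n) / 2)"

definition crosses_infinitely_often :: "(real \<Rightarrow> real) \<Rightarrow> (real \<Rightarrow> real) \<Rightarrow> bool" where
  "crosses_infinitely_often N w \<longleftrightarrow>
     (\<exists>x :: nat \<Rightarrow> real. x 0 > 0 \<and> strict_mono x \<and> filterlim x at_top sequentially \<and>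
        (\<forall>i. N (x i) - w (x i) \<noteq> 0 \<and>
             sgn (N (x (Suc i)) - w (x (Suc i))) = - sgn (N (x i) - w (x i))))"

end

theory Submission
  imports Defs
begin

text \<open>
  A function \<open>f\<close> on the unit sphere of \<open>\<real>\<^sup>N\<close>, \<open>N = n + 1\<close>, is an eigenfunction for
  \<open>t (t + n - 1)\<close> iff its homogeneous extension of degree \<open>t\<close> to \<open>\<real>\<^sup>N - {0}\<close> is harmonic. The
  partial derivatives of the extension are then harmonic of degree \<open>t - 1\<close>, and by Euler's identity
  they determine \<open>f\<close> if \<open>t \<noteq> 0\<close>. Descending in this way, the maximum principle (for \<open>n = 1\<close>:
  periodicity on the circle) excludes all degrees \<open>t \<ge> 0\<close> other than integers and leaves only the
  constants in degree \<open>0\<close>. In degree \<open>k\<close>, a harmonic function is determined by its \<open>k\<close>-th order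
  derivatives with at most one derivative in a distinguished direction \<open>e\<close>, and these constants can
  be prescribed arbitrarily. This gives the multiplicities, and
  \<open>N(x) = (2 K + n) (K + 1) \<cdots> (K + n - 1) / n!\<close> for \<open>K (K + n - 1) \<le> x < (K + 1) (K + n)\<close>, while
  \<open>w(x) = 2 x\<^bsup>n/2\<^esup> / n!\<close>. Hence \<open>N > w\<close> at every positive eigenvalue, and \<open>N < w\<close> just below
  every large eigenvalue.
\<close>

section \<open>Tangential derivatives\<close>

text \<open>\<open>lists_eigenvalues\<close> prescribes the multiplicity of every real number, so
  exhibiting eigenfunctions is not enough: all other smooth ones must be excluded. Instead of
  orthogonality and density of harmonic polynomials, which rest on integration over the sphere, only
  differentiation is used; no function is known to be a polynomial beforehand. Two borderline cases
  escape the plain maximum principle. In degree 0 the eigenvalue is 0 and the principle says nothing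
  about \<open>f\<close>, so it is applied to the squared length of the gradient. For n = 1 no real
  degree gives a negative eigenvalue, hence the appeal to periodicity. The dimension count is the
  Cauchy problem for the Laplace equation with data on the hyperplane orthogonal to
  \<open>e\<close>: the restrictions of F and of its \<open>e\<close>-derivative are arbitrary
  homogeneous polynomials of degrees k and k - 1 in n variables, and the prescribed constants are
  their coefficients up to factorials. The crossings come from comparing squares: the product (K +
  1)...(K + n - 1) is paired with itself in reverse order, each pair being close to x, and 2 K + n
  is compared with 2 sqrt x.\<close>

lemma has_derivative_sgn:
  fixes x :: "'a::euclidean_space"
  assumes "x \<noteq> 0"
  shows "(sgn has_derivative (\<lambda>v. tangent_proj (sgn x) v /\<^sub>R norm x)) (at x)"
proof -
  have "((\<lambda>y. y /\<^sub>R norm y) has_derivative (\<lambda>v. tangent_proj (sgn x) v /\<^sub>R norm x)) (at x)"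
    using assms
    by (auto intro!: derivative_eq_intros has_derivative_norm
        simp: tangent_proj_def fun_eq_iff scaleR_diff_right sgn_div_norm divide_simps power2_eq_square)
  then show ?thesis
    by (simp add: sgn_div_norm[abs_def])
qed

text \<open>Composition with \<open>sgn\<close> is the extension of degree 0. It turns a derivative
  within the sphere, which is arbitrary in the normal direction, into an ordinary derivative at a
  point of an open set.\<close>

lemma has_derivative_comp_sgn:
  fixes f :: "'a::euclidean_space \<Rightarrow> 'b::real_normed_vector"
  assumes "(f has_derivative f') (at (sgn y) within sphere 0 1)" "y \<noteq> 0"
  shows "((\<lambda>y. f (sgn y)) has_derivative (\<lambda>v. f' (tangent_proj (sgn y) v) /\<^sub>R norm y)) (at y)"
proof -
  have lin: "linear f'" using assms(1) has_derivative_linear by blast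
  have o: "open (- {0::'a})" by auto
  have "(f \<circ> sgn has_derivative f' \<circ> (\<lambda>v. tangent_proj (sgn y) v /\<^sub>R norm y)) (at y within - {0})"
  proof (rule diff_chain_within)
    show "(sgn has_derivative (\<lambda>v. tangent_proj (sgn y) v /\<^sub>R norm y)) (at y within - {0})"
      using has_derivative_sgn[OF assms(2)] has_derivative_at_withinI by blast
    show "(f has_derivative f') (at (sgn y) within sgn ` (- {0}))"
      by (rule has_derivative_subset[OF assms(1)]) (auto simp: norm_sgn split: if_split_asm)
  qed
  then have "(f \<circ> sgn has_derivative f' \<circ> (\<lambda>v. tangent_proj (sgn y) v /\<^sub>R norm y)) (at y)"
    using assms(2) by (simp only: at_within_open[OF _ o] Compl_iff singleton_iff not_False_eq_True)
  then show ?thesis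
    by (simp add: o_def linear_scale[OF lin])
qed

lemma sgn_on_sphere: "norm (x::'a::euclidean_space) = 1 \<Longrightarrow> sgn x = x"
  by (simp add: sgn_div_norm)

lemma tangent_proj_tangent: "v \<in> tangent_space x \<Longrightarrow> tangent_proj x v = v"
  by (simp add: tangent_proj_def tangent_space_def)

lemma tangent_proj_mem: "norm x = 1 \<Longrightarrow> tangent_proj x v \<in> tangent_space x"
  by (simp add: tangent_proj_def tangent_space_def inner_diff_left norm_eq_1)

text \<open>Both derivatives induce derivatives of the same extension \<open>f (sgn y)\<close>,
  where uniqueness holds, and these see only the tangential part of a vector.\<close>

lemma sphere_derivative_unique:
  fixes f :: "'a::euclidean_space \<Rightarrow> 'b::real_normed_vector"
  assumes "(f has_derivative f1) (at x within sphere 0 1)" "(f has_derivative f2) (at x within sphere 0 1)"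
    and x: "norm x = 1" and v: "v \<in> tangent_space x"
  shows "f1 v = f2 v"
proof -
  have "x \<noteq> 0" using x by auto
  then have "((\<lambda>y. f (sgn y)) has_derivative (\<lambda>v. f1 (tangent_proj (sgn x) v) /\<^sub>R norm x)) (at x)"
       "((\<lambda>y. f (sgn y)) has_derivative (\<lambda>v. f2 (tangent_proj (sgn x) v) /\<^sub>R norm x)) (at x)"
    using has_derivative_comp_sgn[of f f1 x] has_derivative_comp_sgn[of f f2 x] assms
    by (simp_all add: sgn_on_sphere)
  then have "(\<lambda>v. f1 (tangent_proj (sgn x) v) /\<^sub>R norm x) = (\<lambda>v. f2 (tangent_proj (sgn x) v) /\<^sub>R norm x)"
    by (rule has_derivative_unique)
  then have "f1 (tangent_proj (sgn x) v) /\<^sub>R norm x = f2 (tangent_proj (sgn x) v) /\<^sub>R norm x"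
    by (rule fun_cong)
  then show ?thesis
    using x v by (simp add: sgn_on_sphere tangent_proj_tangent)
qed

lemma sphere_deriv_eq:
  fixes f :: "'a::euclidean_space \<Rightarrow> 'b::real_normed_vector"
  assumes "(f has_derivative f') (at x within sphere 0 1)" "norm x = 1" "v \<in> tangent_space x"
  shows "sphere_deriv f x v = f' v"
  using assms frechet_derivative_works sphere_derivative_unique differentiableI by metis

text \<open>Replaces the definite description in \<open>sphere_grad\<close> and the choice in
  \<open>sphere_deriv\<close> by any derivative at hand. It holds for all ambient \<open>v\<close>
  because the gradient is tangential.\<close>

lemma sphere_grad_inner:
  fixes f :: "'a::euclidean_space \<Rightarrow> real"
  assumes "(f has_derivative f') (at x within sphere 0 1)" and x: "norm x = 1"
  shows "sphere_grad f x \<bullet> v = f' (tangent_proj x v)"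
proof -
  have lin: "linear f'" using assms(1) has_derivative_linear by blast
  have linp: "linear (tangent_proj x)"
    by (auto intro!: linearI simp: tangent_proj_def algebra_simps)
  have linc: "linear (\<lambda>v. f' (tangent_proj x v))"
    using linear_compose[OF linp lin] by (simp add: o_def)
  \<comment> \<open>The Riesz representative of the functional that first projects to the tangent
    space.\<close>
  define g where "g = (\<Sum>c\<in>Basis. f' (tangent_proj x c) *\<^sub>R c)"
  have g: "g \<bullet> v = f' (tangent_proj x v)" for v
    unfolding g_def inner_sum_left inner_scaleR_left
    by (subst (2) euclidean_representation[symmetric, of v], subst linear_sum[OF linc])
       (simp add: linear_scale[OF linc] inner_commute mult.commute)
  have "tangent_proj x x = 0" using x by (simp add: tangent_proj_def norm_eq_1)
  then have gx: "g \<in> tangent_space x"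
    by (simp add: tangent_space_def g linear_0[OF lin])
  have "sphere_grad f x = g"
    unfolding sphere_grad_def
  proof (rule the_equality)
    show "g \<in> tangent_space x \<and> (\<forall>v\<in>tangent_space x. g \<bullet> v = sphere_deriv f x v)"
      using gx assms by (auto simp: g sphere_deriv_eq tangent_proj_tangent)
  next
    fix h assume h: "h \<in> tangent_space x \<and> (\<forall>v\<in>tangent_space x. h \<bullet> v = sphere_deriv f x v)"
    have "h - g \<in> tangent_space x" using h gx by (simp add: tangent_space_def inner_diff_left)
    moreover from this have "h \<bullet> (h - g) = g \<bullet> (h - g)"
      using h assms by (simp add: g sphere_deriv_eq tangent_proj_tangent)
    ultimately show "h = g" by (metis cancel_comm_monoid_add_class.diff_cancel eq_iff_diff_eq_0 inner_diff_left inner_eq_zero_iff)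
  qed
  then show ?thesis by (simp add: g)
qed

text \<open>
  On the sphere, \<open>pd t b f\<close> is the partial derivative in the direction \<open>b\<close> of the extension
  \<open>y \<mapsto> \<bar>y\<bar>\<^sup>t f (y / \<bar>y\<bar>)\<close>. It is homogeneous of degree \<open>t - 1\<close>, so that the Laplacian of
  the extension is \<open>lap t f\<close> below.
\<close>

definition pd :: "real \<Rightarrow> 'a::euclidean_space \<Rightarrow> ('a \<Rightarrow> real) \<Rightarrow> 'a \<Rightarrow> real" where
  "pd t b f x = (if x \<in> sphere 0 1 then sphere_grad f x \<bullet> b + t * (x \<bullet> b) * f x else 0)"

definition sphere_fun :: "('a::euclidean_space \<Rightarrow> real) \<Rightarrow> bool" where
  "sphere_fun f \<longleftrightarrow> sphere_smooth f \<and> (\<forall>x. x \<notin> sphere 0 1 \<longrightarrow> f x = 0)"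

definition sphere_coord :: "'a::euclidean_space \<Rightarrow> 'a \<Rightarrow> real" where
  "sphere_coord b x = (if x \<in> sphere 0 1 then x \<bullet> b else 0)"

definition sphere_const :: "real \<Rightarrow> 'a::euclidean_space \<Rightarrow> real" where
  "sphere_const c x = (if x \<in> sphere 0 1 then c else 0)"

section \<open>Closure properties of smooth functions on the sphere\<close>

lemma has_derivative_sphere_cong:
  assumes "(f has_derivative f') (at x within sphere 0 1)" "\<And>y. y \<in> sphere 0 1 \<Longrightarrow> f y = g y" "x \<in> sphere 0 1"
  shows "(g has_derivative f') (at x within sphere 0 1)"
  using assms has_derivative_transform[of x "sphere 0 1" g f f'] by simp

lemma differentiable_onE:
  assumes "f differentiable_on S" "x \<in> S"
  obtains f' where "(f has_derivative f') (at x within S)"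
  using assms unfolding differentiable_on_def differentiable_def by auto

lemma sphere_grad_cong:
  fixes f :: "'a::euclidean_space \<Rightarrow> real"
  assumes "f differentiable_on sphere 0 1" "\<And>y. y \<in> sphere 0 1 \<Longrightarrow> f y = g y" "x \<in> sphere 0 1"
  shows "sphere_grad f x \<bullet> b = sphere_grad g x \<bullet> b"
proof -
  obtain f' where f': "(f has_derivative f') (at x within sphere 0 1)"
    using assms(1,3) by (rule differentiable_onE)
  with has_derivative_sphere_cong[OF this assms(2,3)] show ?thesis
    using assms(3) by (simp add: sphere_grad_inner)
qed

lemma differentiable_on_cong:
  assumes "f differentiable_on S" "\<And>y. y \<in> S \<Longrightarrow> f y = g y"
  shows "g differentiable_on S"
  using assms unfolding differentiable_on_def differentiable_def
  by (metis has_derivative_transform)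

lemma sphere_Ck_cong:
  fixes f g :: "'a::euclidean_space \<Rightarrow> real"
  assumes "sphere_Ck k f" "\<And>y. y \<in> sphere 0 1 \<Longrightarrow> f y = g y"
  shows "sphere_Ck k g"
  using assms
proof (induction k arbitrary: f g)
  case 0
  then show ?case using continuous_on_cong[of "sphere 0 1" "sphere 0 1" f g] by simp
next
  case (Suc k)
  have d: "f differentiable_on sphere 0 1" using Suc.prems by simp
  have "sphere_Ck k (\<lambda>x. sphere_grad g x \<bullet> b)" if "b \<in> Basis" for b
    using Suc.IH[of "\<lambda>x. sphere_grad f x \<bullet> b" "\<lambda>x. sphere_grad g x \<bullet> b"]
      Suc.prems(1) that sphere_grad_cong[OF d Suc.prems(2)] by simp
  moreover have "g differentiable_on sphere 0 1"
    using differentiable_on_cong[OF d Suc.prems(2)] by simp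
  ultimately show ?case by simp
qed

lemma sphere_Ck_mono: "sphere_Ck (Suc k) f \<Longrightarrow> sphere_Ck k f"
proof (induction k arbitrary: f)
  case 0
  then show ?case by (simp add: differentiable_imp_continuous_on)
next
  case (Suc k)
  have "f differentiable_on sphere 0 1" "\<forall>b\<in>Basis. sphere_Ck (Suc k) (\<lambda>x. sphere_grad f x \<bullet> b)"
    using iffD1[OF sphere_Ck.simps(2) Suc.prems] by blast+
  then show ?case using Suc.IH by (intro iffD2[OF sphere_Ck.simps(2)]) blast
qed

lemma sphere_Ck_add:
  fixes f g :: "'a::euclidean_space \<Rightarrow> real"
  shows "sphere_Ck k f \<Longrightarrow> sphere_Ck k g \<Longrightarrow> sphere_Ck k (\<lambda>x. f x + g x)"
proof (induction k arbitrary: f g)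
  case 0
  then show ?case by (auto intro: continuous_intros)
next
  case (Suc k)
  then have d: "f differentiable_on sphere 0 1" "g differentiable_on sphere 0 1" by auto
  have e: "sphere_grad (\<lambda>x. f x + g x) x \<bullet> b = sphere_grad f x \<bullet> b + sphere_grad g x \<bullet> b"
    if "x \<in> sphere 0 1" for x b
  proof -
    obtain f' where f': "(f has_derivative f') (at x within sphere 0 1)"
      using d(1) \<open>x \<in> sphere 0 1\<close> by (rule differentiable_onE)
    obtain g' where g': "(g has_derivative g') (at x within sphere 0 1)"
      using d(2) \<open>x \<in> sphere 0 1\<close> by (rule differentiable_onE)
    show ?thesis
      using sphere_grad_inner[OF f'] sphere_grad_inner[OF g'] sphere_grad_inner[OF has_derivative_add[OF f' g']] that by simp
  qed
  have "sphere_Ck k (\<lambda>x. sphere_grad (\<lambda>x. f x + g x) x \<bullet> b)" if "b \<in> Basis" for b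
    by (rule sphere_Ck_cong[OF Suc.IH[of "\<lambda>x. sphere_grad f x \<bullet> b" "\<lambda>x. sphere_grad g x \<bullet> b"]])
       (use Suc.prems that e in auto)
  then show ?case using d by (simp add: differentiable_on_add)
qed

lemma sphere_grad_mult:
  fixes f g :: "'a::euclidean_space \<Rightarrow> real"
  assumes d: "f differentiable_on sphere 0 1" "g differentiable_on sphere 0 1" and "x \<in> sphere 0 1"
  shows "sphere_grad (\<lambda>x. f x * g x) x \<bullet> b = f x * (sphere_grad g x \<bullet> b) + (sphere_grad f x \<bullet> b) * g x"
proof -
  obtain f' where f': "(f has_derivative f') (at x within sphere 0 1)"
    using d(1) assms(3) by (rule differentiable_onE)
  obtain g' where g': "(g has_derivative g') (at x within sphere 0 1)"
    using d(2) assms(3) by (rule differentiable_onE)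
  show ?thesis
    using sphere_grad_inner[OF f'] sphere_grad_inner[OF g'] sphere_grad_inner[OF has_derivative_mult[OF f' g']] assms(3) by simp
qed

lemma sphere_Ck_mult:
  fixes f g :: "'a::euclidean_space \<Rightarrow> real"
  shows "sphere_Ck k f \<Longrightarrow> sphere_Ck k g \<Longrightarrow> sphere_Ck k (\<lambda>x. f x * g x)"
proof (induction k arbitrary: f g)
  case 0
  then show ?case by (auto intro: continuous_intros)
next
  case (Suc k)
  then have d: "f differentiable_on sphere 0 1" "g differentiable_on sphere 0 1" by auto
  have m: "sphere_Ck k f" "sphere_Ck k g" using Suc.prems sphere_Ck_mono by auto
  have "sphere_Ck k (\<lambda>x. sphere_grad (\<lambda>x. f x * g x) x \<bullet> b)" if "b \<in> Basis" for b
    by (rule sphere_Ck_cong[OF sphere_Ck_add[OF Suc.IH[of f "\<lambda>x. sphere_grad g x \<bullet> b"] Suc.IH[of "\<lambda>x. sphere_grad f x \<bullet> b" g]]])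
       (use Suc.prems that m d in \<open>auto simp: sphere_grad_mult\<close>)
  then show ?case using d by (simp add: differentiable_on_mult)
qed

lemma sphere_Ck_const: "sphere_Ck k (\<lambda>x::'a::euclidean_space. c)"
proof (induction k arbitrary: c)
  case 0
  then show ?case by simp
next
  case (Suc k)
  have e: "sphere_grad (\<lambda>x::'a. c) x \<bullet> b = 0" if "x \<in> sphere 0 1" for x b
    using sphere_grad_inner[OF has_derivative_const] that by auto
  have "sphere_Ck k (\<lambda>x::'a. sphere_grad (\<lambda>x. c) x \<bullet> b)" for b
    by (rule sphere_Ck_cong[OF Suc.IH[of 0]]) (simp add: e)
  then show ?case by simp
qed

lemma sphere_grad_coord:
  fixes x :: "'a::euclidean_space"
  assumes "norm x = 1"
  shows "sphere_grad (\<lambda>x. x \<bullet> a) x \<bullet> b = a \<bullet> b - (x \<bullet> a) * (x \<bullet> b)"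
proof -
  have "((\<lambda>x. x \<bullet> a) has_derivative (\<lambda>v. v \<bullet> a)) (at x within sphere 0 1)"
    by (auto intro!: derivative_eq_intros)
  from sphere_grad_inner[OF this assms, of b] show ?thesis
    by (simp add: tangent_proj_def algebra_simps inner_commute)
qed

text \<open>By \<open>sphere_grad_coord\<close> the gradient of a coordinate function is built from
  constants and coordinate functions by sums and products, so the induction closes once
  \<open>a\<close> is arbitrary.\<close>

lemma sphere_Ck_coord: "sphere_Ck k (\<lambda>x::'a::euclidean_space. x \<bullet> a)"
proof (induction k arbitrary: a)
  case 0
  then show ?case by (auto intro: continuous_intros)
next
  case (Suc k)
  have "sphere_Ck k (\<lambda>x::'a. sphere_grad (\<lambda>x. x \<bullet> a) x \<bullet> b)" for b
    by (rule sphere_Ck_cong[OF sphere_Ck_add[OF sphere_Ck_const sphere_Ck_mult[OF sphere_Ck_const[of k "-1"] sphere_Ck_mult[OF Suc.IH Suc.IH]]]])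
      (auto simp: sphere_grad_coord)
  moreover have "(\<lambda>x::'a. x \<bullet> a) differentiable_on sphere 0 1"
    by (intro linear_imp_differentiable_on linearI) (simp_all add: inner_add_left)
  ultimately show ?case by simp
qed

lemma sphere_fun_off: "sphere_fun f \<Longrightarrow> norm x \<noteq> 1 \<Longrightarrow> f x = 0"
  by (simp add: sphere_fun_def)

lemma sphere_fun_eqI:
  "sphere_fun f \<Longrightarrow> sphere_fun g \<Longrightarrow> (\<And>x. norm x = 1 \<Longrightarrow> f x = g x) \<Longrightarrow> f = g"
  by (force simp: sphere_fun_def fun_eq_iff)

lemma sphere_fun_Ck: "sphere_fun f \<Longrightarrow> sphere_Ck k f"
  by (simp add: sphere_fun_def sphere_smooth_def)

lemma sphere_fun_differentiable: "sphere_fun f \<Longrightarrow> f differentiable_on sphere 0 1"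
  using sphere_fun_Ck[of f "Suc 0"] by simp

lemma sphere_fun_add: "sphere_fun f \<Longrightarrow> sphere_fun g \<Longrightarrow> sphere_fun (\<lambda>x. f x + g x)"
  by (simp add: sphere_fun_def sphere_smooth_def sphere_Ck_add)

lemma sphere_fun_mult: "sphere_fun f \<Longrightarrow> sphere_fun g \<Longrightarrow> sphere_fun (\<lambda>x. f x * g x)"
  by (simp add: sphere_fun_def sphere_smooth_def sphere_Ck_mult)

lemma sphere_fun_scale: "sphere_fun f \<Longrightarrow> sphere_fun (\<lambda>x. c * f x)"
  by (simp add: sphere_fun_def sphere_smooth_def sphere_Ck_mult[OF sphere_Ck_const])

lemma sphere_fun_0 [simp]: "sphere_fun (\<lambda>x. 0)"
  by (simp add: sphere_fun_def sphere_smooth_def sphere_Ck_const)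

lemma sphere_fun_const: "sphere_fun (sphere_const c)"
  unfolding sphere_fun_def sphere_smooth_def
  by (auto simp: sphere_const_def intro!: sphere_Ck_cong[OF sphere_Ck_const[of _ c]])

lemma sphere_fun_coord: "sphere_fun (sphere_coord b)"
  unfolding sphere_fun_def sphere_smooth_def
  by (auto simp: sphere_coord_def intro!: sphere_Ck_cong[OF sphere_Ck_coord[of _ b]])

lemma sphere_fun_sum: "(\<And>i. i \<in> I \<Longrightarrow> sphere_fun (f i)) \<Longrightarrow> sphere_fun (\<lambda>x. \<Sum>i\<in>I. f i x)"
  by (induction I rule: infinite_finite_induct) (auto intro: sphere_fun_add)

lemma sphere_fun_pd:
  assumes f: "sphere_fun f" and b: "b \<in> Basis"
  shows "sphere_fun (pd t b f)"
proof -
  have "sphere_Ck k (\<lambda>x. sphere_grad f x \<bullet> b)" for k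
    using sphere_fun_Ck[OF f, of "Suc k"] b by simp
  then have "sphere_Ck k (\<lambda>x. sphere_grad f x \<bullet> b + t * ((x \<bullet> b) * f x))" for k
    by (intro sphere_Ck_add sphere_Ck_mult sphere_Ck_const sphere_Ck_coord sphere_fun_Ck[OF f])
  then have "sphere_Ck k (pd t b f)" for k
    by (rule sphere_Ck_cong) (simp add: pd_def)
  then show ?thesis by (simp add: sphere_fun_def sphere_smooth_def pd_def)
qed

lemma sphere_fun_derivative:
  assumes "sphere_fun f" "norm x = 1"
  obtains f' where "(f has_derivative f') (at x within sphere 0 1)"
  using differentiable_onE[OF sphere_fun_differentiable[OF assms(1)], of x] assms(2) by auto

section \<open>Differentiation rules for homogeneous extensions\<close>

lemma pd_shift: "norm x = 1 \<Longrightarrow> pd t b f x = pd 0 b f x + t * (x \<bullet> b) * f x"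
  by (simp add: pd_def)

lemma pd_add:
  assumes "sphere_fun f" "sphere_fun g"
  shows "pd t b (\<lambda>x. f x + g x) x = pd t b f x + pd t b g x"
proof (cases "norm x = 1")
  case True
  obtain f' where f': "(f has_derivative f') (at x within sphere 0 1)"
    using sphere_fun_derivative[OF assms(1) True] .
  obtain g' where g': "(g has_derivative g') (at x within sphere 0 1)"
    using sphere_fun_derivative[OF assms(2) True] .
  show ?thesis
    using True by (simp add: pd_def sphere_grad_inner[OF f'] sphere_grad_inner[OF g'] sphere_grad_inner[OF has_derivative_add[OF f' g']] algebra_simps)
qed (simp add: pd_def)

lemma pd_scale:
  assumes "sphere_fun f"
  shows "pd t b (\<lambda>x. c * f x) x = c * pd t b f x"
proof (cases "norm x = 1")
  case True
  obtain f' where f': "(f has_derivative f') (at x within sphere 0 1)"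
    using sphere_fun_derivative[OF assms(1) True] .
  have "((\<lambda>x. c * f x) has_derivative (\<lambda>v. c * f' v)) (at x within sphere 0 1)"
    using f' by (auto intro!: derivative_eq_intros)
  from sphere_grad_inner[OF this True] show ?thesis
    using True by (simp add: pd_def sphere_grad_inner[OF f'] algebra_simps)
qed (simp add: pd_def)

lemma pd_zero: "pd t b (\<lambda>x. 0) x = 0"
  using pd_scale[of "\<lambda>x. 0" t b 0 x] by simp

lemma pd_sum:
  "(\<And>i. i \<in> I \<Longrightarrow> sphere_fun (f i)) \<Longrightarrow> pd t b (\<lambda>x. \<Sum>i\<in>I. f i x) x = (\<Sum>i\<in>I. pd t b (f i) x)"
  by (induction I rule: infinite_finite_induct) (auto simp: pd_zero pd_add sphere_fun_sum)

text \<open>Leibniz rule: the product of extensions of degrees \<open>s\<close> and \<open>t\<close>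
  is the extension of the product in degree \<open>s + t\<close>.\<close>

lemma pd_mult:
  assumes "sphere_fun f" "sphere_fun g"
  shows "pd (s + t) b (\<lambda>x. f x * g x) x = f x * pd t b g x + pd s b f x * g x"
proof (cases "norm x = 1")
  case True
  then show ?thesis
    using sphere_grad_mult[OF assms[THEN sphere_fun_differentiable], of x b] by (simp add: pd_def algebra_simps)
qed (simp add: pd_def)

lemma pd_coord:
  fixes a b :: "'a::euclidean_space"
  assumes "norm x = 1"
  shows "pd 1 b (sphere_coord a) x = a \<bullet> b"
proof -
  have "sphere_grad (sphere_coord a) x \<bullet> b = sphere_grad (\<lambda>x. x \<bullet> a) x \<bullet> b"
    using assms by (intro sphere_grad_cong sphere_fun_differentiable[OF sphere_fun_coord]) (auto simp: sphere_coord_def)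
  then show ?thesis using assms by (simp add: pd_def sphere_grad_coord) (simp add: sphere_coord_def)
qed

lemma pd_const: "pd 0 b (sphere_const c) x = 0"
proof (cases "norm x = 1")
  case True
  have "sphere_grad (sphere_const c) x \<bullet> b = sphere_grad (\<lambda>x. c) x \<bullet> b"
    using True by (intro sphere_grad_cong sphere_fun_differentiable[OF sphere_fun_const]) (auto simp: sphere_const_def)
  also have "\<dots> = 0" using sphere_grad_inner[OF has_derivative_const] True by auto
  finally show ?thesis by (simp add: pd_def)
qed (simp add: pd_def)

lemma coord_mult_fun: "sphere_fun f \<Longrightarrow> sphere_fun (\<lambda>x. (x \<bullet> b) * f x)"
proof -
  assume f: "sphere_fun f"
  have "(\<lambda>x. (x \<bullet> b) * f x) = (\<lambda>x. sphere_coord b x * f x)"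
    using sphere_fun_off[OF f] by (auto simp: sphere_coord_def fun_eq_iff)
  then show ?thesis using sphere_fun_mult[OF sphere_fun_coord f] by simp
qed

lemma pd_coord_mult:
  assumes f: "sphere_fun f" "norm x = 1"
  shows "pd (t + 1) b (\<lambda>x. (x \<bullet> a) * f x) x = (x \<bullet> a) * pd t b f x + (a \<bullet> b) * f x"
proof -
  have "(\<lambda>x. (x \<bullet> a) * f x) = (\<lambda>x. sphere_coord a x * f x)"
    using sphere_fun_off[OF f(1)] by (auto simp: sphere_coord_def fun_eq_iff)
  then show ?thesis
    using pd_mult[OF sphere_fun_coord f(1), of 1 t b a x] assms
    by (simp add: pd_coord add.commute) (simp add: sphere_coord_def)
qed

section \<open>Second derivatives and the Laplacian\<close>

text \<open>The mean value theorem in direction \<open>a\<close> reduces the second difference to a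
  first difference of \<open>A\<close>, which is then expanded at the single point \<open>x\<close>.
  The expression on the left is symmetric in \<open>a\<close> and \<open>b\<close>, which is its
  use.\<close>

lemma second_difference_tendsto:
  fixes F A :: "'a::real_normed_vector \<Rightarrow> real"
  assumes U: "open U" "x \<in> U"
    and FA: "\<And>y. y \<in> U \<Longrightarrow> ((\<lambda>s. F (y + s *\<^sub>R a)) has_real_derivative A y) (at 0)"
    and A': "(A has_derivative A') (at x)"
  shows "((\<lambda>h. (F (x + h *\<^sub>R a + h *\<^sub>R b) - F (x + h *\<^sub>R a) - F (x + h *\<^sub>R b) + F x) / h\<^sup>2) \<longlongrightarrow> A' b) (at_right 0)"
proof (rule tendstoI)
  fix e :: real assume "e > 0"
  define K where "K = norm a + norm b + 1"
  have K: "K > 0" by (simp add: K_def add_nonneg_pos)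
  \<comment> \<open>Displacements have norm at most \<open>h * K\<close>. Two expansion errors of
    size \<open>e' * (h * K)\<close> add up to \<open>h * (e / 2)\<close>, strictly less than
    \<open>h * e\<close>.\<close>
  define e' where "e' = e / (4 * K)"
  have e': "e' > 0" using \<open>e > 0\<close> K by (simp add: e'_def)
  have lin: "linear A'" using A' has_derivative_linear by blast
  obtain d1 where d1: "d1 > 0" "\<And>y. norm (y - x) < d1 \<Longrightarrow> norm (A y - A x - A' (y - x)) \<le> e' * norm (y - x)"
    using A' e' unfolding has_derivative_at_alt by metis
  obtain d2 where d2: "d2 > 0" "ball x d2 \<subseteq> U" using U openE by blast
  define d where "d = min d1 d2 / K"
  have d: "d > 0" using d1 d2 K by (simp add: d_def)
  have "dist ((F (x + h *\<^sub>R a + h *\<^sub>R b) - F (x + h *\<^sub>R a) - F (x + h *\<^sub>R b) + F x) / h\<^sup>2) (A' b) < e"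
    if h: "0 < h" "h < d" for h
  proof -
    have hK: "h * K < d1" "h * K < d2" using h K by (auto simp: d_def divide_simps)
    have nb: "norm (s *\<^sub>R a + r *\<^sub>R b) \<le> h * K" if "0 \<le> s" "s \<le> h" "0 \<le> r" "r \<le> h" for s r
    proof -
      have "norm (s *\<^sub>R a + r *\<^sub>R b) \<le> s * norm a + r * norm b"
        using that norm_triangle_ineq[of "s *\<^sub>R a" "r *\<^sub>R b"] by simp
      also have "\<dots> \<le> h * norm a + h * norm b"
        using that by (intro add_mono mult_right_mono) auto
      also have "\<dots> \<le> h * K" using h by (simp add: K_def algebra_simps)
      finally show ?thesis .
    qed
    have inU: "x + (s *\<^sub>R a + r *\<^sub>R b) \<in> U" if "0 \<le> s" "s \<le> h" "0 \<le> r" "r \<le> h" for s r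
    proof -
      have "dist x (x + (s *\<^sub>R a + r *\<^sub>R b)) = norm (s *\<^sub>R a + r *\<^sub>R b)"
        by (metis add_diff_cancel_left' dist_commute dist_norm)
      then show ?thesis using nb[OF that] hK by (intro subsetD[OF d2(2)]) simp
    qed
    \<comment> \<open>The second difference is the increment over \<open>[0, h]\<close> of this
      first difference in direction \<open>b\<close>.\<close>
    define g where "g s = F (x + (s *\<^sub>R a + h *\<^sub>R b)) - F (x + (s *\<^sub>R a + 0 *\<^sub>R b))" for s
    have DF: "((\<lambda>s. F (x + (s *\<^sub>R a + r *\<^sub>R b))) has_real_derivative A (x + (s *\<^sub>R a + r *\<^sub>R b))) (at s)"
      if "0 \<le> s" "s \<le> h" "0 \<le> r" "r \<le> h" for s r
    proof -
      have "((\<lambda>u. F (x + (s *\<^sub>R a + r *\<^sub>R b) + u *\<^sub>R a)) has_real_derivative A (x + (s *\<^sub>R a + r *\<^sub>R b))) (at 0)"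
        by (rule FA[OF inU[OF that]])
      then have "((\<lambda>u. F (x + ((s + u) *\<^sub>R a + r *\<^sub>R b))) has_real_derivative A (x + (s *\<^sub>R a + r *\<^sub>R b))) (at 0)"
        by (simp add: algebra_simps)
      then show ?thesis
        using DERIV_shift[of "\<lambda>s. F (x + (s *\<^sub>R a + r *\<^sub>R b))" _ 0 s] by (simp add: add.commute)
    qed
    have "\<exists>z. 0 < z \<and> z < h \<and> g h - g 0 = (h - 0) * (A (x + (z *\<^sub>R a + h *\<^sub>R b)) - A (x + (z *\<^sub>R a + 0 *\<^sub>R b)))"
      unfolding g_def
      by (rule MVT2[OF h(1)]) (use h in \<open>auto intro!: DERIV_diff DF simp del: scaleR_zero_left\<close>)
    then obtain z where z: "0 < z" "z < h"
      "g h - g 0 = h * (A (x + (z *\<^sub>R a + h *\<^sub>R b)) - A (x + (z *\<^sub>R a + 0 *\<^sub>R b)))" by auto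
    have est: "\<bar>A (x + (z *\<^sub>R a + r *\<^sub>R b)) - A x - (z * A' a + r * A' b)\<bar> \<le> e' * (h * K)" if "0 \<le> r" "r \<le> h" for r
    proof -
      have n: "norm (z *\<^sub>R a + r *\<^sub>R b) \<le> h * K" using nb z that by auto
      have "A' (z *\<^sub>R a + r *\<^sub>R b) = z * A' a + r * A' b"
        using lin by (simp add: linear_add linear_scale)
      then have "\<bar>A (x + (z *\<^sub>R a + r *\<^sub>R b)) - A x - (z * A' a + r * A' b)\<bar> \<le> e' * norm (z *\<^sub>R a + r *\<^sub>R b)"
        using d1(2)[of "x + (z *\<^sub>R a + r *\<^sub>R b)"] n hK by simp
      also have "\<dots> \<le> e' * (h * K)" using n e' by (intro mult_left_mono) auto
      finally show ?thesis .
    qed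
    have "\<bar>A (x + (z *\<^sub>R a + h *\<^sub>R b)) - A (x + (z *\<^sub>R a + 0 *\<^sub>R b)) - h * A' b\<bar> \<le> 2 * (e' * (h * K))"
      using est[of h] est[of 0] h by (simp only: abs_le_iff) (auto simp: algebra_simps)
    then have "\<bar>g h - g 0 - h * (h * A' b)\<bar> \<le> h * (2 * (e' * (h * K)))"
      using h unfolding z(3) right_diff_distrib[symmetric] by (simp add: abs_mult)
    also have "h * (2 * (e' * (h * K))) = h\<^sup>2 * (e / 2)"
      using K by (simp add: e'_def power2_eq_square)
    finally have "\<bar>g h - g 0 - h\<^sup>2 * A' b\<bar> \<le> h\<^sup>2 * (e / 2)" by (simp add: power2_eq_square mult.assoc)
    then have "\<bar>(g h - g 0) / h\<^sup>2 - A' b\<bar> \<le> e / 2"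
      using h by (simp add: field_simps abs_le_iff)
    moreover have "g h - g 0 = F (x + h *\<^sub>R a + h *\<^sub>R b) - F (x + h *\<^sub>R a) - F (x + h *\<^sub>R b) + F x"
      by (simp add: g_def algebra_simps)
    ultimately show ?thesis using \<open>e > 0\<close> by (simp add: dist_real_def)
  qed
  then show "\<forall>\<^sub>F h in at_right 0. dist ((F (x + h *\<^sub>R a + h *\<^sub>R b) - F (x + h *\<^sub>R a) - F (x + h *\<^sub>R b) + F x) / h\<^sup>2) (A' b) < e"
    unfolding eventually_at_right_field using d by auto
qed

text \<open>Both values are the limit of one and the same second difference.\<close>

lemma mixed_derivatives_symmetric:
  fixes F A B :: "'a::real_normed_vector \<Rightarrow> real"
  assumes "open U" "x \<in> U"
    and "\<And>y. y \<in> U \<Longrightarrow> ((\<lambda>s. F (y + s *\<^sub>R a)) has_real_derivative A y) (at 0)"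
    and "\<And>y. y \<in> U \<Longrightarrow> ((\<lambda>s. F (y + s *\<^sub>R b)) has_real_derivative B y) (at 0)"
    and "(A has_derivative A') (at x)" "(B has_derivative B') (at x)"
  shows "A' b = B' a"
proof -
  have e: "F (x + h *\<^sub>R a + h *\<^sub>R b) - F (x + h *\<^sub>R a) - F (x + h *\<^sub>R b) + F x =
    F (x + h *\<^sub>R b + h *\<^sub>R a) - F (x + h *\<^sub>R b) - F (x + h *\<^sub>R a) + F x" for h
    by (simp add: algebra_simps)
  show ?thesis
    using second_difference_tendsto[OF assms(1,2,3,5), where b=b]
      second_difference_tendsto[OF assms(1,2,4,6), where b=a]
    unfolding e by (rule tendsto_unique[OF trivial_limit_at_right_real])
qed

lemma has_real_derivative_comp_sgn:
  assumes f: "sphere_fun f" and y: "y \<noteq> 0"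
  shows "((\<lambda>s. f (sgn (y + s *\<^sub>R a))) has_real_derivative pd 0 a f (sgn y) / norm y) (at 0)"
proof -
  have n: "norm (sgn y) = 1" using y by (simp add: norm_sgn)
  obtain f' where f': "(f has_derivative f') (at (sgn y) within sphere 0 1)"
    using sphere_fun_derivative[OF f n] .
  have lin: "linear f'" using f' has_derivative_linear by blast
  have linp: "tangent_proj (sgn y) (s *\<^sub>R a) = s *\<^sub>R tangent_proj (sgn y) a" for s
    by (simp add: tangent_proj_def algebra_simps)
  have "((\<lambda>y. f (sgn y)) has_derivative (\<lambda>v. f' (tangent_proj (sgn y) v) /\<^sub>R norm y)) (at (y + 0 *\<^sub>R a))"
    using has_derivative_comp_sgn[OF f' y] by simp
  moreover have "((\<lambda>s. y + s *\<^sub>R a) has_derivative (\<lambda>s. s *\<^sub>R a)) (at 0)"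
    by (auto intro!: derivative_eq_intros)
  ultimately have "((\<lambda>s. f (sgn (y + s *\<^sub>R a))) has_derivative (\<lambda>s. f' (tangent_proj (sgn y) (s *\<^sub>R a)) /\<^sub>R norm y)) (at 0)"
    using has_derivative_compose[of "\<lambda>s. y + s *\<^sub>R a" "\<lambda>s. s *\<^sub>R a" 0 UNIV "\<lambda>y. f (sgn y)"] by simp
  then have "((\<lambda>s. f (sgn (y + s *\<^sub>R a))) has_real_derivative f' (tangent_proj (sgn y) a) / norm y) (at 0)"
    unfolding has_field_derivative_def linp linear_scale[OF lin]
    by (rule has_derivative_eq_rhs) (simp add: fun_eq_iff divide_inverse)
  then show ?thesis
    using sphere_grad_inner[OF f' n, of a] n by (simp add: pd_def)
qed

text \<open>By \<open>has_real_derivative_comp_sgn\<close>, the partial derivatives of an extension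
  of degree 0 have the form \<open>g (sgn y) / norm y\<close>; this lemma differentiates them once
  more.\<close>

lemma has_derivative_comp_sgn_over_norm:
  assumes g: "sphere_fun g" and x: "norm x = 1"
  shows "((\<lambda>y. g (sgn y) / norm y) has_derivative (\<lambda>v. sphere_grad g x \<bullet> v - (x \<bullet> v) * g x)) (at x)"
proof -
  have x0: "x \<noteq> 0" using x by auto
  have s: "sgn x = x" using x by (rule sgn_on_sphere)
  obtain g' where g': "(g has_derivative g') (at x within sphere 0 1)"
    using sphere_fun_derivative[OF g x] .
  have 1: "((\<lambda>y. g (sgn y)) has_derivative (\<lambda>v. g' (tangent_proj x v))) (at x)"
    using has_derivative_comp_sgn[of g g' x] g' x x0 s by simp
  have 2: "(norm has_derivative (\<lambda>v. x \<bullet> v)) (at x)"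
    using has_derivative_norm[OF x0] s by (simp add: inner_commute)
  show ?thesis
    using has_derivative_divide[OF 1 2] x x0 s
    by (simp add: sphere_grad_inner[OF g' x]) (simp add: algebra_simps)
qed

text \<open>Symmetry of second derivatives for \<open>f (sgn y)\<close> off the origin. Its first
  derivatives have degree -1, which explains the outer index.\<close>

lemma pd_pd_0_commute:
  assumes f: "sphere_fun f" and ab: "a \<in> Basis" "b \<in> Basis" and x: "norm x = 1"
  shows "pd (-1) b (pd 0 a f) x = pd (-1) a (pd 0 b f) x"
proof -
  have "sphere_grad (pd 0 a f) x \<bullet> b - (x \<bullet> b) * pd 0 a f x = sphere_grad (pd 0 b f) x \<bullet> a - (x \<bullet> a) * pd 0 b f x"
    by (rule mixed_derivatives_symmetric[where U="- {0}" and x=x and F="\<lambda>y. f (sgn y)"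
        and A="\<lambda>y. pd 0 a f (sgn y) / norm y" and B="\<lambda>y. pd 0 b f (sgn y) / norm y"])
      (use x f ab in \<open>auto intro!: has_real_derivative_comp_sgn has_derivative_comp_sgn_over_norm sphere_fun_pd\<close>)
  then show ?thesis using x by (simp add: pd_def algebra_simps)
qed

text \<open>Reduction to degree 0. All correction terms are symmetric in \<open>a\<close> and
  \<open>b\<close>, which gives \<open>pd_commute\<close>, and their trace gives
  \<open>lap_eq\<close>.\<close>

lemma pd_pd:
  assumes f: "sphere_fun f" and ab: "a \<in> Basis" "b \<in> Basis" and x: "norm x = 1"
  shows "pd (t - 1) a (pd t b f) x = pd (-1) a (pd 0 b f) x
     + t * ((x \<bullet> a) * pd 0 b f x + (x \<bullet> b) * pd 0 a f x) + t * (b \<bullet> a) * f x + t * (t - 2) * (x \<bullet> a) * (x \<bullet> b) * f x"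
proof -
  have "pd t b f = (\<lambda>x. pd 0 b f x + t * ((x \<bullet> b) * f x))"
    using sphere_fun_off[OF f] by (auto simp: pd_def fun_eq_iff)
  then have "pd (t - 1) a (pd t b f) x = pd (t - 1) a (pd 0 b f) x + t * pd (t - 1) a (\<lambda>x. (x \<bullet> b) * f x) x"
    using f ab by (simp add: pd_add pd_scale sphere_fun_pd coord_mult_fun sphere_fun_scale)
  also have "pd (t - 1) a (\<lambda>x. (x \<bullet> b) * f x) x = (x \<bullet> b) * pd 0 a f x + (b \<bullet> a) * f x + (t - 2) * (x \<bullet> a) * (x \<bullet> b) * f x"
    using pd_coord_mult[OF f x, of 0 a b] x by (simp add: pd_def algebra_simps)
  also have "pd (t - 1) a (pd 0 b f) x = pd (-1) a (pd 0 b f) x + t * (x \<bullet> a) * pd 0 b f x"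
    using x by (simp add: pd_def algebra_simps)
  finally show ?thesis by (simp add: algebra_simps)
qed

lemma pd_commute:
  assumes f: "sphere_fun f" and ab: "a \<in> Basis" "b \<in> Basis"
  shows "pd (t - 1) a (pd t b f) = pd (t - 1) b (pd t a f)"
proof (rule sphere_fun_eqI)
  fix x :: 'a assume x: "norm x = 1"
  show "pd (t - 1) a (pd t b f) x = pd (t - 1) b (pd t a f) x"
    unfolding pd_pd[OF f ab x] pd_pd[OF f ab(2,1) x] pd_pd_0_commute[OF f ab x] inner_commute[of b a]
    by (simp only: ac_simps)
qed (use f ab in \<open>auto intro!: sphere_fun_pd\<close>)

text \<open>The gradient is orthogonal to \<open>x\<close>, so only the radial term
  \<open>t * (x \<bullet> b) * f x\<close> of \<open>pd\<close> contributes, and \<open>x\<close>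
  has length 1.\<close>

lemma euler:
  assumes f: "sphere_fun f" and x: "norm x = 1"
  shows "(\<Sum>b\<in>Basis. (x \<bullet> b) * pd t b f x) = t * f x"
proof -
  obtain f' where f': "(f has_derivative f') (at x within sphere 0 1)"
    using sphere_fun_derivative[OF f x] .
  have lin: "linear f'" using f' has_derivative_linear by blast
  have "tangent_proj x x = 0" using x by (simp add: tangent_proj_def norm_eq_1)
  then have "sphere_grad f x \<bullet> x = 0" by (simp add: sphere_grad_inner[OF f' x] linear_0[OF lin])
  then have 1: "(\<Sum>b\<in>Basis. (x \<bullet> b) * (sphere_grad f x \<bullet> b)) = 0"
    using euclidean_inner[of x "sphere_grad f x"] by (simp add: inner_commute)
  have 2: "(\<Sum>b\<in>Basis. (x \<bullet> b) * (x \<bullet> b)) = 1"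
    using euclidean_inner[of x x] x by (simp add: norm_eq_1)
  have "(\<Sum>b\<in>Basis. (x \<bullet> b) * pd t b f x)
      = (\<Sum>b\<in>Basis. (x \<bullet> b) * (sphere_grad f x \<bullet> b)) + t * f x * (\<Sum>b\<in>Basis. (x \<bullet> b) * (x \<bullet> b))"
    using x by (simp add: pd_def sum_distrib_left flip: sum.distrib) (simp add: algebra_simps)
  then show ?thesis using 1 2 by simp
qed

lemma pd_fun_add: "sphere_fun f \<Longrightarrow> sphere_fun g \<Longrightarrow> pd t b (\<lambda>x. f x + g x) = (\<lambda>x. pd t b f x + pd t b g x)"
  by (simp add: fun_eq_iff pd_add)

lemma pd_fun_scale: "sphere_fun f \<Longrightarrow> pd t b (\<lambda>x. c * f x) = (\<lambda>x. c * pd t b f x)"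
  by (simp add: fun_eq_iff pd_scale)

lemma pd_fun_zero: "pd t b (\<lambda>x. 0) = (\<lambda>x. 0)"
  by (simp add: fun_eq_iff pd_zero)

lemma pd_fun_sum: "(\<And>i. i \<in> I \<Longrightarrow> sphere_fun (f i)) \<Longrightarrow> pd t b (\<lambda>x. \<Sum>i\<in>I. f i x) = (\<lambda>x. \<Sum>i\<in>I. pd t b (f i) x)"
  by (simp add: fun_eq_iff pd_sum)

section \<open>The Laplacian of homogeneous extensions and the spherical Laplacian\<close>

definition lap :: "real \<Rightarrow> ('a::euclidean_space \<Rightarrow> real) \<Rightarrow> 'a \<Rightarrow> real" where
  "lap t f x = (\<Sum>b\<in>Basis. pd (t - 1) b (pd t b f) x)"

text \<open>Trace of \<open>pd_pd\<close>. The terms with first derivatives vanish by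
  \<open>euler\<close> in degree 0, and the rest is t DIM + t (t - 2) times
  \<open>f x\<close>.\<close>

lemma lap_eq:
  fixes f :: "'a::euclidean_space \<Rightarrow> real"
  assumes f: "sphere_fun f" and x: "norm x = 1"
  shows "lap t f x = lap 0 f x + t * (t + DIM('a) - 2) * f x"
proof -
  have 2: "(\<Sum>b\<in>Basis. (x \<bullet> b) * (x \<bullet> b)) = 1"
    using euclidean_inner[of x x] x by (simp add: norm_eq_1)
  have 3: "(\<Sum>b\<in>Basis. b \<bullet> (b::'a)) = DIM('a)" by simp
  have "lap t f x = (\<Sum>b\<in>Basis. pd (-1) b (pd 0 b f) x
     + t * ((x \<bullet> b) * pd 0 b f x + (x \<bullet> b) * pd 0 b f x) + t * (b \<bullet> b) * f x + t * (t - 2) * (x \<bullet> b) * (x \<bullet> b) * f x)"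
    unfolding lap_def by (intro sum.cong refl pd_pd[OF f _ _ x])
  also have "\<dots> = lap 0 f x + 2 * t * (\<Sum>b\<in>Basis. (x \<bullet> b) * pd 0 b f x) + t * f x * (\<Sum>b\<in>Basis. b \<bullet> (b::'a))
      + t * (t - 2) * f x * (\<Sum>b\<in>Basis. (x \<bullet> b) * (x \<bullet> b))"
    by (simp add: lap_def sum_distrib_left sum.distrib sum_subtractf algebra_simps)
  also have "\<dots> = lap 0 f x + t * (t + DIM('a) - 2) * f x"
    unfolding euler[OF f x] 2 3 by (simp add: algebra_simps)
  finally show ?thesis .
qed

text \<open>Changing the outer degree from -1 to 0 adds the radial derivative of an extension of
  degree 0, which is zero. With both degrees 0, the Leibniz rule and the divergence apply without
  shifts.\<close>

lemma sum_pd_0_pd_0: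
  assumes f: "sphere_fun f" and x: "norm x = 1"
  shows "(\<Sum>b\<in>Basis. pd 0 b (pd 0 b f) x) = lap 0 f x"
proof -
  have "lap 0 f x = (\<Sum>b\<in>Basis. pd 0 b (pd 0 b f) x - (x \<bullet> b) * pd 0 b f x)"
    unfolding lap_def using x by (intro sum.cong) (auto simp: pd_def)
  then show ?thesis using euler[OF f x, of 0] by (simp add: sum_subtractf)
qed

text \<open>On the sphere the gradient has components \<open>pd 0 c f\<close>, so the divergence is
  the sum of the \<open>pd 0 b (pd 0 b f)\<close> minus the trace of the normal part removed by
  \<open>tangent_proj\<close>.\<close>

lemma sphere_laplacian_eq:
  assumes f: "sphere_fun f" and x: "norm x = 1"
  shows "sphere_laplacian f x = - lap 0 f x"
proof -
  have "\<exists>g'. (pd 0 c f has_derivative g') (at x within sphere 0 1)" if "c \<in> Basis" for c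
    using sphere_fun_derivative[OF sphere_fun_pd[OF f that] x] by metis
  then obtain g' where g': "\<And>c. c \<in> Basis \<Longrightarrow> (pd 0 c f has_derivative g' c) (at x within sphere 0 1)" by metis
  have "((\<lambda>y. \<Sum>c\<in>Basis. pd 0 c f y *\<^sub>R c) has_derivative (\<lambda>v. \<Sum>c\<in>Basis. g' c v *\<^sub>R c)) (at x within sphere 0 1)"
    by (intro has_derivative_sum has_derivative_scaleR_left g')
  then have G: "(sphere_grad f has_derivative (\<lambda>v. \<Sum>c\<in>Basis. g' c v *\<^sub>R c)) (at x within sphere 0 1)"
    by (rule has_derivative_sphere_cong) (use x in \<open>auto simp: pd_def euclidean_representation\<close>)
  have e: "g' c (tangent_proj x v) = pd 0 v (pd 0 c f) x" if "c \<in> Basis" for c v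
    using sphere_grad_inner[OF g'[OF that] x, of v] x unfolding pd_def[of 0 v] by simp
  have D: "sphere_deriv (sphere_grad f) x (tangent_proj x v) = (\<Sum>c\<in>Basis. pd 0 v (pd 0 c f) x *\<^sub>R c)" for v
    by (simp add: sphere_deriv_eq[OF G x tangent_proj_mem[OF x]] e)
  have c: "covariant_deriv (sphere_grad f) x (tangent_proj x b) \<bullet> b
      = pd 0 b (pd 0 b f) x - (x \<bullet> b) * (\<Sum>c\<in>Basis. pd 0 b (pd 0 c f) x * (x \<bullet> c))" if "b \<in> Basis" for b
    using that unfolding covariant_deriv_def D
    by (simp add: tangent_proj_def inner_diff_left inner_sum_left inner_Basis if_distrib cong: if_cong)
       (simp add: inner_commute)
  \<comment> \<open>This is the normal part. After exchanging the sums, the inner one is the radial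
    derivative of the degree 0 extension of \<open>pd 0 c f\<close>.\<close>
  have "(\<Sum>b\<in>Basis. (x \<bullet> b) * (\<Sum>c\<in>Basis. pd 0 b (pd 0 c f) x * (x \<bullet> c)))
     = (\<Sum>c\<in>Basis. (x \<bullet> c) * (\<Sum>b\<in>Basis. (x \<bullet> b) * pd 0 b (pd 0 c f) x))"
    unfolding sum_distrib_left by (subst sum.swap) (simp add: mult_ac)
  also have "\<dots> = 0" using euler[OF sphere_fun_pd[OF f] x, of _ 0 0] by simp
  finally show ?thesis
    unfolding sphere_laplacian_def sphere_div_def
    by (simp add: c sum_subtractf sum_pd_0_pd_0[OF f x])
qed

definition harm :: "real \<Rightarrow> ('a::euclidean_space \<Rightarrow> real) set" where
  "harm t = {f. sphere_fun f \<and> (\<forall>x. norm x = 1 \<longrightarrow> lap t f x = 0)}"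

lemma eigenspace_eq_harm:
  fixes t :: real
  shows "eigenspace (t * (t + real DIM('a) - 2)) = (harm t :: ('a::euclidean_space \<Rightarrow> real) set)"
  unfolding eigenspace_def harm_def
  by (auto simp: sphere_fun_def lap_eq[of _ _ t] sphere_laplacian_eq neg_eq_iff_add_eq_0)

lemma harm_sphere_fun: "f \<in> harm t \<Longrightarrow> sphere_fun f"
  by (simp add: harm_def)

text \<open>The Laplacian commutes with partial derivatives; every differentiation lowers the degree
  by one, and \<open>pd_commute\<close> is used at degrees \<open>t\<close> and
  \<open>t - 1\<close>.\<close>

lemma harm_pd:
  assumes "f \<in> harm t" and b: "b \<in> Basis"
  shows "pd t b f \<in> harm (t - 1)"
proof -
  have f: "sphere_fun f" using assms by (simp add: harm_def)
  have s: "sphere_fun (pd t a f)" if "a \<in> Basis" for a using sphere_fun_pd[OF f that] .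
  \<comment> \<open>Stated as an equality of functions, not of values at points of the sphere, so
    that it can be differentiated.\<close>
  have z: "(\<lambda>x. \<Sum>a\<in>Basis. pd (t - 1) a (pd t a f) x) = (\<lambda>x. 0)"
    by (rule sphere_fun_eqI) (use assms in \<open>auto simp: harm_def lap_def intro!: sphere_fun_sum sphere_fun_pd\<close>)
  have "lap (t - 1) (pd t b f) x = 0" if x: "norm x = 1" for x
  proof -
    have "lap (t - 1) (pd t b f) x = (\<Sum>a\<in>Basis. pd (t - 1 - 1) a (pd (t - 1) b (pd t a f)) x)"
      unfolding lap_def using b by (intro sum.cong refl) (simp add: pd_commute[OF f b])
    also have "\<dots> = (\<Sum>a\<in>Basis. pd (t - 1 - 1) b (pd (t - 1) a (pd t a f)) x)"
      using b s by (intro sum.cong refl fun_cong[OF pd_commute])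
    also have "\<dots> = pd (t - 1 - 1) b (\<lambda>x. \<Sum>a\<in>Basis. pd (t - 1) a (pd t a f) x) x"
      using s by (subst pd_sum) (auto intro: sphere_fun_pd)
    also have "\<dots> = 0" by (simp add: z pd_zero)
    finally show ?thesis .
  qed
  then show ?thesis using s[OF b] by (simp add: harm_def)
qed

lemma harm_0: "(\<lambda>x. 0) \<in> harm t"
  by (simp add: harm_def lap_def pd_fun_zero)

lemma harm_add: "f \<in> harm t \<Longrightarrow> g \<in> harm t \<Longrightarrow> (\<lambda>x. f x + g x) \<in> harm t"
  by (simp add: harm_def sphere_fun_add lap_def pd_fun_add sphere_fun_pd sum.distrib)

lemma harm_scale: "f \<in> harm t \<Longrightarrow> (\<lambda>x. c * f x) \<in> harm t"
  by (simp add: harm_def sphere_fun_scale lap_def pd_fun_scale sphere_fun_pd flip: sum_distrib_left)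

lemma harm_sum: "(\<And>i. i \<in> I \<Longrightarrow> f i \<in> harm t) \<Longrightarrow> (\<lambda>x. \<Sum>i\<in>I. f i x) \<in> harm t"
  by (induction I rule: infinite_finite_induct) (auto intro: harm_add harm_0)

lemma harm_eq_0I:
  assumes f: "f \<in> harm t" and t: "t \<noteq> 0" and z: "\<And>b. b \<in> Basis \<Longrightarrow> pd t b f = (\<lambda>x. 0)"
  shows "f = (\<lambda>x. 0)"
proof (rule sphere_fun_eqI)
  fix x :: 'a assume "norm x = 1"
  from euler[OF harm_sphere_fun[OF f] this, of t] z t show "f x = 0" by simp
qed (use f in \<open>auto simp: harm_def\<close>)

section \<open>Eigenfunctions of non-integral degree\<close>

text \<open>A maximum on the sphere is also a maximum of the degree 0 extension off the origin, so
  each pure second derivative along a straight line is at most 0.\<close>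

lemma lap_0_nonpos_at_max:
  assumes f: "sphere_fun f" and x: "norm x = 1" and max: "\<And>y. norm y = 1 \<Longrightarrow> f y \<le> f x"
  shows "lap 0 f x \<le> 0"
proof -
  have "pd (-1) b (pd 0 b f) x \<le> 0" if b: "b \<in> Basis" for b
  proof (rule ccontr)
    assume "\<not> pd (-1) b (pd 0 b f) x \<le> 0"
    then have pos: "0 < pd (-1) b (pd 0 b f) x" by simp
    have s: "sgn x = x" using x by (rule sgn_on_sphere)
    \<comment> \<open>\<open>F\<close> is the extension along the line through \<open>x\<close> in
      direction \<open>b\<close>, and \<open>F1\<close> its derivative;
      \<open>\<bar>r\<bar> < 1\<close> keeps the line off the origin. If the second derivative were
      positive, \<open>F1\<close> would vanish at 0 and be positive just after it, so
      \<open>F\<close> would exceed its maximum.\<close>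
    define F where "F r = f (sgn (x + r *\<^sub>R b))" for r
    define F1 where "F1 r = pd 0 b f (sgn (x + r *\<^sub>R b)) / norm (x + r *\<^sub>R b)" for r
    have nz: "x + r *\<^sub>R b \<noteq> 0" if "\<bar>r\<bar> < 1" for r
    proof
      assume "x + r *\<^sub>R b = 0"
      then have "norm x = norm (r *\<^sub>R b)" by (metis add_eq_0_iff norm_minus_cancel)
      then show False using x b that by simp
    qed
    have dF: "(F has_real_derivative F1 r) (at r)" if "\<bar>r\<bar> < 1" for r
    proof -
      have "((\<lambda>u. F (r + u)) has_real_derivative F1 r) (at 0)"
        using has_real_derivative_comp_sgn[OF f nz[OF that], of b]
        by (simp add: F_def F1_def algebra_simps)
      then show ?thesis using DERIV_shift[of F _ 0 r] by (simp add: add.commute)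
    qed
    have "(F1 has_real_derivative pd (-1) b (pd 0 b f) x) (at 0)"
    proof -
      have "((\<lambda>r. x + r *\<^sub>R b) has_derivative (\<lambda>r. r *\<^sub>R b)) (at 0)"
        by (auto intro!: derivative_eq_intros)
      moreover have "((\<lambda>y. pd 0 b f (sgn y) / norm y) has_derivative
          (\<lambda>v. sphere_grad (pd 0 b f) x \<bullet> v - (x \<bullet> v) * pd 0 b f x)) (at (x + 0 *\<^sub>R b))"
        using has_derivative_comp_sgn_over_norm[OF sphere_fun_pd[OF f b, of 0] x] by simp
      ultimately have "(F1 has_derivative (\<lambda>r. sphere_grad (pd 0 b f) x \<bullet> (r *\<^sub>R b) - (x \<bullet> (r *\<^sub>R b)) * pd 0 b f x)) (at 0)"
        unfolding F1_def[abs_def] by (rule has_derivative_compose)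
      then show ?thesis
        unfolding has_field_derivative_def
        by (rule has_derivative_eq_rhs) (use x in \<open>simp add: fun_eq_iff pd_def[of "-1"] algebra_simps\<close>)
    qed
    then obtain d where d: "d > 0" "\<And>h. 0 < h \<Longrightarrow> h < d \<Longrightarrow> F1 0 < F1 h"
      using DERIV_pos_inc_right[OF _ pos, of F1 0] by auto
    have le: "F r \<le> F 0" if "\<bar>r\<bar> < 1" for r
      using max[of "sgn (x + r *\<^sub>R b)"] nz[OF that] s by (simp add: F_def norm_sgn)
    have "F1 0 = 0"
      by (rule DERIV_local_max[OF dF, of 0 "1"]) (use le in auto)
    define h where "h = min (d / 2) (1 / 2)"
    have h: "0 < h" "h < d" "h < 1" using d by (auto simp: h_def)
    obtain z where z: "0 < z" "z < h" "F h - F 0 = (h - 0) * F1 z"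
      using MVT2[OF h(1), of F F1] dF h by auto
    have "F1 z > 0" using d(2)[of z] z h \<open>F1 0 = 0\<close> by auto
    then have "F h - F 0 > 0" using z h by simp
    then show False using le[of h] h by simp
  qed
  then show ?thesis unfolding lap_def by (intro sum_nonpos) simp
qed

lemma sphere_fun_attains_max:
  fixes f :: "'a::euclidean_space \<Rightarrow> real"
  assumes f: "sphere_fun f"
  obtains x where "norm x = 1" "\<And>y. norm y = 1 \<Longrightarrow> f y \<le> f x"
proof -
  have c: "continuous_on (sphere 0 1) f" using sphere_fun_Ck[OF f, of 0] by simp
  obtain b :: 'a where "b \<in> Basis" using nonempty_Basis by blast
  then have "b \<in> sphere 0 1" by simp
  then have "\<exists>x\<in>sphere 0 1. \<forall>y\<in>sphere 0 1. f y \<le> f x"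
    by (intro continuous_attains_sup c compact_sphere) auto
  then show ?thesis using that by auto
qed

lemma lap_scale: "sphere_fun f \<Longrightarrow> lap t (\<lambda>x. c * f x) x = c * lap t f x"
  by (simp add: lap_def pd_fun_scale sphere_fun_pd sum_distrib_left)

text \<open>At a maximum point, \<open>r * f x\<close> is at most 0, hence \<open>f\<close> is
  nonpositive everywhere; the same holds for its negative.\<close>

lemma eq_0_of_lap_0_eq_pos:
  fixes f :: "'a::euclidean_space \<Rightarrow> real"
  assumes f: "sphere_fun f" and r: "r > 0" and eq: "\<And>x. norm x = 1 \<Longrightarrow> lap 0 f x = r * f x"
  shows "f = (\<lambda>x. 0)"
proof -
  have le: "g y \<le> 0"
    if sg: "sphere_fun g" and eqg: "\<And>x. norm x = 1 \<Longrightarrow> lap 0 g x = r * g x" and y: "norm y = 1"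
    for g :: "'a \<Rightarrow> real" and y
  proof -
    obtain x where x: "norm x = 1" "\<And>y. norm y = 1 \<Longrightarrow> g y \<le> g x"
      using sphere_fun_attains_max[OF sg] by blast
    have "r * g x \<le> 0" using lap_0_nonpos_at_max[OF sg x] eqg[OF x(1)] by linarith
    then have "g x \<le> 0" using r by (simp add: mult_le_0_iff)
    then show ?thesis using x(2)[OF y] by linarith
  qed
  have neg: "lap 0 (\<lambda>x. (- 1) * f x) x = r * ((- 1) * f x)" if "norm x = 1" for x
    unfolding lap_scale[OF f] eq[OF that] by simp
  show ?thesis
  proof (rule sphere_fun_eqI[OF f sphere_fun_0])
    fix x :: 'a assume x: "norm x = 1"
    show "f x = 0" using le[OF f eq x] le[OF sphere_fun_scale[OF f, of "-1"] neg x] by simp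
  qed
qed

text \<open>The eigenvalue would be negative. With DIM > 2 this covers the degrees strictly between
  2 - DIM and 0; with DIM = 2 the product is a square and the range is empty, so the circle calls
  for a different argument.\<close>

lemma harm_eq_0_of_neg:
  fixes f :: "'a::euclidean_space \<Rightarrow> real"
  assumes f: "f \<in> harm t" and t: "t * (t + DIM('a) - 2) < 0"
  shows "f = (\<lambda>x. 0)"
proof (rule eq_0_of_lap_0_eq_pos[OF harm_sphere_fun[OF f]])
  show "0 < - (t * (t + DIM('a) - 2))" using t by simp
  show "lap 0 f x = - (t * (t + DIM('a) - 2)) * f x" if "norm x = 1" for x
    using f that lap_eq[OF harm_sphere_fun[OF f] that, of t] by (simp add: harm_def)
qed

section \<open>Degree 0, and degrees between 0 and 1\<close>

lemma sphere_fun_constant: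
  fixes f :: "'a::euclidean_space \<Rightarrow> real"
  assumes N: "2 \<le> DIM('a)" and f: "sphere_fun f" and z: "\<And>b. b \<in> Basis \<Longrightarrow> pd 0 b f = (\<lambda>x. 0)"
  shows "\<exists>c. f = sphere_const c"
proof -
  have D: "((\<lambda>y. f (sgn y)) has_derivative (\<lambda>v. 0)) (at y)" if "y \<in> - {0}" for y
  proof -
    have y: "y \<noteq> 0" "norm (sgn y) = 1" using that by (auto simp: norm_sgn)
    obtain f' where f': "(f has_derivative f') (at (sgn y) within sphere 0 1)"
      using sphere_fun_derivative[OF f y(2)] .
    have "sphere_grad f (sgn y) \<bullet> b = 0" if "b \<in> Basis" for b
      using fun_cong[OF z[OF that], of "sgn y"] y(2) by (simp add: pd_def)
    then have "sphere_grad f (sgn y) = 0" by (intro euclidean_eqI[of "sphere_grad f (sgn y)" 0]) simp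
    then have "f' (tangent_proj (sgn y) v) = 0" for v
      using sphere_grad_inner[OF f' y(2), of v] by simp
    then show ?thesis using has_derivative_comp_sgn[OF f' y(1)] by simp
  qed
  obtain b :: 'a where "b \<in> Basis" using nonempty_Basis by blast
  then have b: "norm b = 1" "b \<in> - {0}" by auto
  have "f (sgn x) = f (sgn b)" if "x \<in> - {0}" for x
    by (rule has_derivative_zero_unique_connected[of "- {0}" "\<lambda>y. f (sgn y)"])
       (use D b that connected_punctured_universe[OF N, of 0] in auto)
  moreover have "x \<noteq> 0" if "norm x = 1" for x :: 'a using that by auto
  ultimately have "f x = f b" if "norm x = 1" for x
    using that b by (metis Compl_iff sgn_on_sphere singletonD)
  then have "f = sphere_const (f b)"
    using sphere_fun_off[OF f] by (auto simp: sphere_const_def fun_eq_iff)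
  then show ?thesis by blast
qed

text \<open>The source of the squared Hessian in the Bochner-type argument of
  \<open>harm_0_constant_of_ge_3\<close>.\<close>

lemma lap_0_square:
  assumes g: "sphere_fun g" and x: "norm x = 1"
  shows "lap 0 (\<lambda>x. g x * g x) x = 2 * (g x * lap 0 g x) + 2 * (\<Sum>a\<in>Basis. (pd 0 a g x)\<^sup>2)"
proof -
  have 1: "pd 0 a (pd 0 a (\<lambda>x. g x * g x)) x = 2 * (g x * pd 0 a (pd 0 a g) x) + 2 * (pd 0 a g x)\<^sup>2"
    if a: "a \<in> Basis" for a
  proof -
    have "pd 0 a (\<lambda>x. g x * g x) = (\<lambda>x. 2 * (g x * pd 0 a g x))"
      using pd_mult[OF g g, of 0 0 a] by (simp add: fun_eq_iff mult.commute)
    then show ?thesis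
      using pd_mult[OF g sphere_fun_pd[OF g a, of 0], of 0 0 a x] g a
      by (simp add: pd_scale sphere_fun_mult sphere_fun_pd power2_eq_square)
  qed
  have "(\<Sum>a\<in>Basis. pd 0 a (pd 0 a (\<lambda>x. g x * g x)) x) = (\<Sum>a\<in>Basis. 2 * (g x * pd 0 a (pd 0 a g) x) + 2 * (pd 0 a g x)\<^sup>2)"
    by (rule sum.cong[OF refl 1])
  then show ?thesis
    unfolding sum_pd_0_pd_0[OF sphere_fun_mult[OF g g] x] sum_pd_0_pd_0[OF g x, symmetric]
    by (simp add: sum.distrib sum_distrib_left)
qed

lemma lap_sum:
  "(\<And>i. i \<in> I \<Longrightarrow> sphere_fun (f i)) \<Longrightarrow> lap t (\<lambda>x. \<Sum>i\<in>I. f i x) x = (\<Sum>i\<in>I. lap t (f i) x)"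
  unfolding lap_def by (subst sum.swap) (simp add: pd_fun_sum sphere_fun_pd)

text \<open>Let \<open>P\<close> be the squared length of the gradient. Its components have degree
  -1 and satisfy \<open>lp\<close>, so \<open>lap 0 P\<close> is a nonnegative multiple of
  \<open>P\<close> plus twice the squared Hessian; the factor DIM - 3 is nonnegative by assumption.
  At a maximum of \<open>P\<close> this sum is at most 0, so the Hessian vanishes there. Since DIM =
  3 loses the term with \<open>P\<close>, the gradient is recovered from the Hessian.\<close>

lemma harm_0_constant_of_ge_3:
  fixes f :: "'a::euclidean_space \<Rightarrow> real"
  assumes N: "3 \<le> DIM('a)" and f: "f \<in> harm 0"
  shows "\<exists>c. f = sphere_const c"
proof -
  have sf: "sphere_fun f" using f by (rule harm_sphere_fun)
  have sp: "sphere_fun (pd 0 b f)" if "b \<in> Basis" for b using sphere_fun_pd[OF sf that] .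
  have lp: "lap 0 (pd 0 b f) x = real (DIM('a) - 3) * pd 0 b f x" if b: "b \<in> Basis" and x: "norm x = 1" for b x
  proof -
    have "pd 0 b f \<in> harm (-1)" using harm_pd[OF f b] by simp
    then show ?thesis using lap_eq[OF sp[OF b] x, of "-1"] x N by (simp add: harm_def of_nat_diff algebra_simps)
  qed
  define P where "P x = (\<Sum>b\<in>Basis. pd 0 b f x * pd 0 b f x)" for x
  have sP: "sphere_fun P"
    unfolding P_def by (intro sphere_fun_sum sphere_fun_mult sp)
  have lP: "lap 0 P x = 2 * real (DIM('a) - 3) * P x + 2 * (\<Sum>b\<in>Basis. \<Sum>a\<in>Basis. (pd 0 a (pd 0 b f) x)\<^sup>2)"
    if x: "norm x = 1" for x
  proof -
    have "lap 0 P x = (\<Sum>b\<in>Basis. 2 * (pd 0 b f x * lap 0 (pd 0 b f) x) + 2 * (\<Sum>a\<in>Basis. (pd 0 a (pd 0 b f) x)\<^sup>2))"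
      unfolding P_def by (subst lap_sum) (auto simp: lap_0_square sp x sphere_fun_mult)
    then show ?thesis
      by (simp add: lp x sum.distrib sum_distrib_left P_def algebra_simps)
  qed
  obtain x where x: "norm x = 1" "\<And>y. norm y = 1 \<Longrightarrow> P y \<le> P x"
    using sphere_fun_attains_max[OF sP] by blast
  have P0: "P y \<ge> 0" for y unfolding P_def by (intro sum_nonneg) simp
  have S0: "(\<Sum>b\<in>Basis. \<Sum>a\<in>Basis. (pd 0 a (pd 0 b f) x)\<^sup>2) \<ge> 0" by (intro sum_nonneg) simp
  have "2 * real (DIM('a) - 3) * P x \<ge> 0" using P0[of x] by simp
  then have "(\<Sum>b\<in>Basis. \<Sum>a\<in>Basis. (pd 0 a (pd 0 b f) x)\<^sup>2) = 0"
    using lap_0_nonpos_at_max[OF sP x] lP[OF x(1)] S0 by linarith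
  then have hess: "pd 0 a (pd 0 b f) x = 0" if "a \<in> Basis" "b \<in> Basis" for a b
    using that by (subst (asm) sum_nonneg_eq_0_iff; (auto intro: sum_nonneg)?) (auto simp: sum_nonneg_eq_0_iff)
  have grad: "pd 0 a f x = 0" if a: "a \<in> Basis" for a
  proof -
    \<comment> \<open>Euler's identity for the gradient, whose degree is \<open>-1\<close>, expresses the gradient by the Hessian.\<close>
    have "- pd 0 a f x = (\<Sum>b\<in>Basis. (x \<bullet> b) * pd (-1) b (pd 0 a f) x)"
      using euler[OF sp[OF a] x(1), of "-1"] by simp
    \<comment> \<open>With the two directions exchanged, the vanishing Hessian leaves only the shift
      from degree 0 to -1, a multiple of the radial derivative of the degree 0 extension of
      \<open>f\<close>.\<close>
    also have "\<dots> = (\<Sum>b\<in>Basis. - (x \<bullet> a) * ((x \<bullet> b) * pd 0 b f x))"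
      using a x(1)
      by (intro sum.cong refl, subst pd_pd_0_commute[OF sf a _ x(1)]) (simp_all add: pd_shift[of x "-1"] hess)
    also have "\<dots> = 0" unfolding sum_distrib_left[symmetric] euler[OF sf x(1)] by simp
    finally show ?thesis by simp
  qed
  have "P x = 0" unfolding P_def by (simp add: grad)
  then have P: "P y = 0" if "norm y = 1" for y using x(2)[OF that] P0[of y] by simp
  have "pd 0 b f = (\<lambda>x. 0)" if b: "b \<in> Basis" for b
  proof (rule sphere_fun_eqI[OF sp[OF b] sphere_fun_0])
    fix y :: 'a assume "norm y = 1"
    from P[OF this] show "pd 0 b f y = 0"
      using b by (simp add: P_def sum_nonneg_eq_0_iff)
  qed
  then show ?thesis using sphere_fun_constant[OF _ sf] N by simp
qed

lemma has_real_derivative_on_circle: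
  fixes u v :: "'a::euclidean_space"
  assumes Basis: "Basis = {u, v}" "u \<noteq> v" and f: "sphere_fun f"
  shows "((\<lambda>\<theta>. f (cos \<theta> *\<^sub>R u + sin \<theta> *\<^sub>R v)) has_real_derivative
     - sin \<theta> * pd 0 u f (cos \<theta> *\<^sub>R u + sin \<theta> *\<^sub>R v) + cos \<theta> * pd 0 v f (cos \<theta> *\<^sub>R u + sin \<theta> *\<^sub>R v)) (at \<theta>)"
proof -
  define p where "p \<theta> = cos \<theta> *\<^sub>R u + sin \<theta> *\<^sub>R v" for \<theta>
  have uv: "u \<bullet> u = 1" "v \<bullet> v = 1" "u \<bullet> v = 0" "v \<bullet> u = 0"
    using inner_same_Basis[of u] inner_same_Basis[of v] inner_not_same_Basis[of u v] inner_not_same_Basis[of v u]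
      Basis(2) unfolding Basis(1) by auto
  have n: "norm (p \<theta>) = 1" for \<theta>
    by (simp add: norm_eq_1 p_def inner_add_left inner_add_right uv flip: power2_eq_square)
  obtain f' where f': "(f has_derivative f') (at (p \<theta>) within sphere 0 1)"
    using sphere_fun_derivative[OF f n] .
  have lin: "linear f'" using f' has_derivative_linear by blast
  define q where "q = - sin \<theta> *\<^sub>R u + cos \<theta> *\<^sub>R v"
  have dp: "(p has_derivative (\<lambda>s. s *\<^sub>R q)) (at \<theta>)"
    unfolding p_def q_def by (auto intro!: derivative_eq_intros simp: algebra_simps)
  have "(f \<circ> p has_derivative f' \<circ> (\<lambda>s. s *\<^sub>R q)) (at \<theta>)"
    by (rule diff_chain_within[OF dp]) (rule has_derivative_subset[OF f'], use n in auto)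
  then have 1: "((\<lambda>\<theta>. f (p \<theta>)) has_real_derivative f' q) (at \<theta>)"
    unfolding has_field_derivative_def o_def
    by (rule has_derivative_eq_rhs) (simp add: fun_eq_iff linear_scale[OF lin])
  have "q \<in> tangent_space (p \<theta>)"
    by (simp add: tangent_space_def q_def p_def inner_add_left inner_add_right inner_diff_left uv)
  then have "f' q = sphere_grad f (p \<theta>) \<bullet> q"
    by (simp add: sphere_grad_inner[OF f' n] tangent_proj_tangent)
  also have "\<dots> = - sin \<theta> * pd 0 u f (p \<theta>) + cos \<theta> * pd 0 v f (p \<theta>)"
    using n by (simp add: pd_def q_def inner_add_right inner_diff_right)
  finally show ?thesis using 1 by (simp add: p_def)
qed

text \<open>In the angle, the eigenvalue equation becomes the oscillator equation with frequency
  \<open>t\<close> and \<open>2 * pi\<close>-periodic solutions; \<open>h\<close> is the angular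
  derivative of \<open>f\<close>.\<close>

lemma harm_on_circle:
  fixes f :: "'a::euclidean_space \<Rightarrow> real"
  assumes N: "DIM('a) = 2" and f: "f \<in> harm t"
  obtains p :: "real \<Rightarrow> 'a" and h where "range p = sphere 0 1" "\<And>\<theta>. p (\<theta> + 2 * pi) = p \<theta>"
    "\<And>\<theta>. ((\<lambda>\<theta>. f (p \<theta>)) has_real_derivative h \<theta>) (at \<theta>)"
    "\<And>\<theta>. (h has_real_derivative - t\<^sup>2 * f (p \<theta>)) (at \<theta>)"
    "\<And>\<theta>. h (\<theta> + 2 * pi) = h \<theta>"
proof -
  obtain u v :: 'a where Basis: "Basis = {u, v}" "u \<noteq> v" using N card_2_iff[of "Basis :: 'a set"] by auto
  define p where "p \<theta> = cos \<theta> *\<^sub>R u + sin \<theta> *\<^sub>R v" for \<theta>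
  define h where "h \<theta> = - sin \<theta> * pd 0 u f (p \<theta>) + cos \<theta> * pd 0 v f (p \<theta>)" for \<theta>
  have sf: "sphere_fun f" using f by (rule harm_sphere_fun)
  have uv: "u \<bullet> u = 1" "v \<bullet> v = 1" "u \<bullet> v = 0" "v \<bullet> u = 0"
    using inner_same_Basis[of u] inner_same_Basis[of v] inner_not_same_Basis[of u v] inner_not_same_Basis[of v u]
      Basis(2) unfolding Basis(1) by auto
  have n: "norm (p \<theta>) = 1" for \<theta>
    by (simp add: norm_eq_1 p_def inner_add_left inner_add_right uv flip: power2_eq_square)
  have D: "((\<lambda>\<theta>. g (p \<theta>)) has_real_derivative - sin \<theta> * pd 0 u g (p \<theta>) + cos \<theta> * pd 0 v g (p \<theta>)) (at \<theta>)"
    if "sphere_fun g" for g \<theta>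
    using has_real_derivative_on_circle[OF Basis that] by (simp add: p_def)
  have su: "sphere_fun (pd 0 u f)" and sv: "sphere_fun (pd 0 v f)"
    using Basis sf by (auto intro: sphere_fun_pd)
  have coords: "p \<theta> \<bullet> u = cos \<theta>" "p \<theta> \<bullet> v = sin \<theta>" for \<theta>
    by (simp_all add: p_def inner_add_left uv)
  have E: "cos \<theta> * pd 0 u g (p \<theta>) + sin \<theta> * pd 0 v g (p \<theta>) = 0" if "sphere_fun g" for g \<theta>
    using euler[OF that n, of \<theta> 0] Basis(2) unfolding Basis(1) by (simp add: coords)
  have dh: "(h has_real_derivative - t\<^sup>2 * f (p \<theta>)) (at \<theta>)" for \<theta>
  proof -
    let ?c = "cos \<theta>" and ?s = "sin \<theta>"
    let ?uu = "pd 0 u (pd 0 u f) (p \<theta>)" and ?vu = "pd 0 v (pd 0 u f) (p \<theta>)"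
    let ?uv = "pd 0 u (pd 0 v f) (p \<theta>)" and ?vv = "pd 0 v (pd 0 v f) (p \<theta>)"
    have "(h has_real_derivative (- ?c * pd 0 u f (p \<theta>) + (- ?s * ?uu + ?c * ?vu) * - ?s)
       + (- ?s * pd 0 v f (p \<theta>) + (- ?s * ?uv + ?c * ?vv) * ?c)) (at \<theta>)"
      unfolding h_def
      by (intro DERIV_add DERIV_mult D su sv DERIV_cos) (auto intro!: derivative_eq_intros)
    also have "(- ?c * pd 0 u f (p \<theta>) + (- ?s * ?uu + ?c * ?vu) * - ?s)
       + (- ?s * pd 0 v f (p \<theta>) + (- ?s * ?uv + ?c * ?vv) * ?c) = ?uu + ?vv"
    proof -
      have 1: "?c * pd 0 u f (p \<theta>) + ?s * pd 0 v f (p \<theta>) = 0" "?c * ?uu + ?s * ?vu = 0" "?c * ?uv + ?s * ?vv = 0"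
        using E[OF sf] E[OF su] E[OF sv] by auto
      have 2: "?c * ?c + ?s * ?s = 1" using sin_cos_squared_add3 .
      \<comment> \<open>The three radial identities remove the first derivatives and turn the mixed
        terms into \<open>?c * ?c * ?uu\<close> and \<open>?s * ?s * ?vv\<close>, which complete the
        squares.\<close>
      show ?thesis using 1 2 by algebra
    qed
    also have "?uu + ?vv = lap 0 f (p \<theta>)"
      using sum_pd_0_pd_0[OF sf n, of \<theta>] Basis(2) unfolding Basis(1) by simp
    also have "\<dots> = - t\<^sup>2 * f (p \<theta>)"
      using lap_eq[OF sf n, of t \<theta>] f n N by (simp add: harm_def power2_eq_square eq_neg_iff_add_eq_0)
    finally show ?thesis .
  qed
  have "x \<in> range p" if x: "norm x = 1" for x
  proof -
    have x2: "x = (x \<bullet> u) *\<^sub>R u + (x \<bullet> v) *\<^sub>R v"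
      using euclidean_representation[of x] Basis(2) unfolding Basis(1) by simp
    have "(x \<bullet> u)\<^sup>2 + (x \<bullet> v)\<^sup>2 = 1"
      using euclidean_inner[of x x] Basis(2) x unfolding Basis(1) by (simp add: norm_eq_1 power2_eq_square)
    then obtain \<theta> where "x \<bullet> u = cos \<theta>" "x \<bullet> v = sin \<theta>" using sincos_total_2pi by metis
    then have "x = p \<theta>" using x2 by (simp add: p_def)
    then show ?thesis by blast
  qed
  then have r: "range p = sphere 0 1" using n by auto
  show ?thesis
    by (rule that[of p h]) (use r dh D[OF sf] in \<open>auto simp: h_def p_def\<close>)
qed

text \<open>The angular derivative is constant, and it vanishes somewhere because \<open>f\<close>
  returns to its value after one period.\<close>

lemma harm_0_constant_of_eq_2:
  fixes f :: "'a::euclidean_space \<Rightarrow> real"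
  assumes N: "DIM('a) = 2" and f: "f \<in> harm 0"
  shows "\<exists>c. f = sphere_const c"
proof -
  obtain p h where p: "range p = sphere (0::'a) 1" "\<And>\<theta>. p (\<theta> + 2 * pi) = p \<theta>"
    "\<And>\<theta>. ((\<lambda>\<theta>. f (p \<theta>)) has_real_derivative h \<theta>) (at \<theta>)"
    "\<And>\<theta>. (h has_real_derivative - 0\<^sup>2 * f (p \<theta>)) (at \<theta>)"
    using harm_on_circle[OF N f] by metis
  have hc: "h a = h b" for a b using p(4) DERIV_isconst_all[of h] by auto
  obtain z where "f (p (2 * pi)) - f (p 0) = (2 * pi - 0) * h z"
    using MVT2[of 0 "2 * pi" "\<lambda>\<theta>. f (p \<theta>)" h] p(3) by auto
  moreover have "p (2 * pi) = p 0" using p(2)[of 0] by simp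
  ultimately have "h z = 0" by simp
  then have "h a = 0" for a using hc[of a z] by simp
  then have gc: "f (p a) = f (p 0)" for a using p(3) DERIV_isconst_all[of "\<lambda>\<theta>. f (p \<theta>)"] by auto
  have "f x = f (p 0)" if x: "norm x = 1" for x
  proof -
    have "x \<in> range p" using x p(1) by auto
    then show ?thesis using gc by auto
  qed
  then have "f = sphere_const (f (p 0))"
    using sphere_fun_off[OF harm_sphere_fun[OF f]] by (auto simp: sphere_const_def fun_eq_iff)
  then show ?thesis by blast
qed

lemma harm_eq_0_on_circle:
  fixes f :: "'a::euclidean_space \<Rightarrow> real"
  assumes N: "DIM('a) = 2" and f: "f \<in> harm t" and t: "0 < t" "t < 1"
  shows "f = (\<lambda>x. 0)"
proof (rule sphere_fun_eqI[OF harm_sphere_fun[OF f] sphere_fun_0])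
  obtain p h where p: "range p = sphere (0::'a) 1" "\<And>\<theta>. p (\<theta> + 2 * pi) = p \<theta>"
    "\<And>\<theta>. ((\<lambda>\<theta>. f (p \<theta>)) has_real_derivative h \<theta>) (at \<theta>)"
    "\<And>\<theta>. (h has_real_derivative - t\<^sup>2 * f (p \<theta>)) (at \<theta>)" "\<And>\<theta>. h (\<theta> + 2 * pi) = h \<theta>"
    using harm_on_circle[OF N f] by metis
  define c where "c = cos (t * (2 * pi))"
  define s where "s = sin (t * (2 * pi))"
  have "c \<noteq> 1"
  proof
    assume "c = 1"
    then obtain k :: int where "t * (2 * pi) = real_of_int k * 2 * pi"
      unfolding c_def cos_one_2pi_int by auto
    then have "t = k" by simp
    then show False using t by simp
  qed
  fix x :: 'a assume "norm x = 1"
  then obtain a where a: "x = p a" using p(1) by (metis imageE mem_sphere_0)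
  \<comment> \<open>Both functions are constant; comparing \<open>a\<close> with \<open>a + 2 * pi\<close> shows that \<open>(f (p a), h a / t)\<close>
    is fixed by the rotation through the angle \<open>2 * pi * t\<close>.\<close>
  define W1 where "W1 \<theta> = f (p \<theta>) * (t * cos (t * (\<theta> - a))) - h \<theta> * sin (t * (\<theta> - a))" for \<theta>
  define W2 where "W2 \<theta> = f (p \<theta>) * (t * sin (t * (\<theta> - a))) + h \<theta> * cos (t * (\<theta> - a))" for \<theta>
  have "(W1 has_real_derivative 0) (at \<theta>)" "(W2 has_real_derivative 0) (at \<theta>)" for \<theta>
    unfolding W1_def W2_def
    by (auto intro!: derivative_eq_intros p(3,4) simp: algebra_simps power2_eq_square)
  then have "W1 (a + 2 * pi) = W1 a" "W2 (a + 2 * pi) = W2 a"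
    using DERIV_isconst_all[of W1] DERIV_isconst_all[of W2] by auto
  then have e: "f x * (t * c) - h a * s = f x * t" "f x * (t * s) + h a * c = h a"
    using p(2)[of a] p(5)[of a] a by (auto simp: W1_def W2_def c_def s_def)
  have cs: "c\<^sup>2 + s\<^sup>2 = 1" by (simp add: c_def s_def)
  \<comment> \<open>The factor \<open>2 * (1 - c)\<close> is the determinant of the identity minus
    the rotation, nonzero unless the angle is a multiple of \<open>2 * pi\<close>.\<close>
  have "(f x * t) * (2 * (1 - c)) = 0"
    using e cs by algebra
  then show "f x = 0" using \<open>c \<noteq> 1\<close> t by auto
qed

lemma harm_0_constant:
  fixes f :: "'a::euclidean_space \<Rightarrow> real"
  assumes "2 \<le> DIM('a)" "f \<in> harm 0"
  shows "\<exists>c. f = sphere_const c"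
  using assms harm_0_constant_of_eq_2[of f] harm_0_constant_of_ge_3[of f]
  by (cases "DIM('a) = 2") auto

text \<open>For DIM at least 3 the first derivatives have degree between -1 and 0, where eigenvalues
  are negative; this starts the descent of \<open>harm_eq_0_of_nonint\<close>.\<close>

lemma harm_eq_0_of_less_1:
  fixes f :: "'a::euclidean_space \<Rightarrow> real"
  assumes N: "2 \<le> DIM('a)" and f: "f \<in> harm t" and t: "0 < t" "t < 1"
  shows "f = (\<lambda>x. 0)"
proof (cases "DIM('a) = 2")
  case True
  then show ?thesis using harm_eq_0_on_circle[OF True f t] by simp
next
  case False
  have "pd t b f = (\<lambda>x. 0)" if "b \<in> Basis" for b
    by (rule harm_eq_0_of_neg[OF harm_pd[OF f that]]) (use N t False in \<open>auto simp: mult_less_0_iff\<close>)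
  then show ?thesis using harm_eq_0I[OF f] t by simp
qed

lemma harm_eq_0_of_nonint:
  fixes f :: "'a::euclidean_space \<Rightarrow> real"
  assumes N: "2 \<le> DIM('a)"
  shows "f \<in> harm t \<Longrightarrow> real k < t \<Longrightarrow> t < real k + 1 \<Longrightarrow> f = (\<lambda>x. 0)"
proof (induction k arbitrary: t f)
  case 0
  then show ?case using harm_eq_0_of_less_1[OF N] by simp
next
  case (Suc k)
  have "pd t b f = (\<lambda>x. 0)" if "b \<in> Basis" for b
    by (rule Suc.IH[OF harm_pd[OF Suc.prems(1) that]]) (use Suc.prems in auto)
  then show ?case using harm_eq_0I[OF Suc.prems(1)] Suc.prems(2) by simp
qed

section \<open>Dimension of the eigenspaces\<close>

text \<open>Poincare lemma for homogeneous fields. Euler's identity dictates the potential: the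
  radial component of the field divided by the degree \<open>t + 1\<close>. The assumption
  \<open>sym\<close> says that the field is closed, and \<open>div\<close> makes the potential
  harmonic.\<close>

lemma harm_potential:
  fixes g :: "'a::euclidean_space \<Rightarrow> 'a \<Rightarrow> real"
  assumes g: "\<And>b. b \<in> Basis \<Longrightarrow> g b \<in> harm t" and t: "t + 1 \<noteq> 0"
    and sym: "\<And>a b. a \<in> Basis \<Longrightarrow> b \<in> Basis \<Longrightarrow> pd t a (g b) = pd t b (g a)"
    and div: "\<And>x. (\<Sum>b\<in>Basis. pd t b (g b) x) = 0"
  obtains f where "f \<in> harm (t + 1)" "\<And>b. b \<in> Basis \<Longrightarrow> pd (t + 1) b f = g b"
proof -
  have sg: "sphere_fun (g b)" if "b \<in> Basis" for b using g[OF that] by (rule harm_sphere_fun)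
  define f where "f x = 1 / (t + 1) * (\<Sum>b\<in>Basis. (x \<bullet> b) * g b x)" for x
  have ss: "sphere_fun (\<lambda>x. \<Sum>b\<in>Basis. (x \<bullet> b) * g b x)"
    by (intro sphere_fun_sum coord_mult_fun sg)
  have sf: "sphere_fun f" unfolding f_def by (intro sphere_fun_scale ss)
  have p: "pd (t + 1) a f = g a" if a: "a \<in> Basis" for a
  proof (rule sphere_fun_eqI[OF sphere_fun_pd[OF sf a] sg[OF a]])
    fix x :: 'a assume x: "norm x = 1"
    have "pd (t + 1) a f x = 1 / (t + 1) * (\<Sum>b\<in>Basis. pd (t + 1) a (\<lambda>x. (x \<bullet> b) * g b x) x)"
      unfolding f_def by (subst pd_scale[OF ss], subst pd_sum) (auto intro: coord_mult_fun sg)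
    also have "(\<Sum>b\<in>Basis. pd (t + 1) a (\<lambda>x. (x \<bullet> b) * g b x) x)
        = (\<Sum>b\<in>Basis. (x \<bullet> b) * pd t b (g a) x + (if b = a then g b x else 0))"
      using a by (intro sum.cong refl) (auto simp: pd_coord_mult[OF sg x] sym[OF a] inner_Basis)
    also have "\<dots> = (t + 1) * g a x"
      using a by (simp add: sum.distrib euler[OF sg[OF a] x] algebra_simps)
    finally show "pd (t + 1) a f x = g a x" using t by simp
  qed
  have "f \<in> harm (t + 1)"
    using sf div by (simp add: harm_def lap_def p)
  then show ?thesis using that p by blast
qed

text \<open>
  \<open>cauchy_data e k f c d\<close>: the constants \<open>c M\<close>, with \<open>size M = k\<close>, and \<open>d M\<close>, with
  \<open>size M + 1 = k\<close>, are the derivatives \<open>\<partial>\<^sup>M F\<close> and \<open>\<partial>\<^sub>e \<partial>\<^sup>M F\<close> of the harmonic homogeneous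
  extension \<open>F\<close> of \<open>f\<close> of degree \<open>k\<close>, for multisets \<open>M\<close> of directions other than \<open>e\<close>. Double
  derivatives in the direction \<open>e\<close> are eliminated by \<open>\<Delta> F = 0\<close>. Other values of \<open>c\<close> and
  \<open>d\<close> are irrelevant.
\<close>

primrec cauchy_data ::
  "'a::euclidean_space \<Rightarrow> nat \<Rightarrow> ('a \<Rightarrow> real) \<Rightarrow> ('a multiset \<Rightarrow> real) \<Rightarrow> ('a multiset \<Rightarrow> real) \<Rightarrow> bool" where
  "cauchy_data e 0 f c d \<longleftrightarrow> f = sphere_const (c {#})"
| "cauchy_data e (Suc k) f c d \<longleftrightarrow>
     (\<forall>b\<in>Basis - {e}. cauchy_data e k (pd (real (Suc k)) b f) (\<lambda>M. c (add_mset b M)) (\<lambda>M. d (add_mset b M))) \<and>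
     cauchy_data e k (pd (real (Suc k)) e f) d (\<lambda>M. - (\<Sum>b\<in>Basis - {e}. c (add_mset b (add_mset b M))))"

lemma cauchy_data_cong:
  assumes "cauchy_data e k f c d"
    and "\<And>M. set_mset M \<subseteq> Basis - {e} \<Longrightarrow> size M = k \<Longrightarrow> c M = c' M"
    and "\<And>M. set_mset M \<subseteq> Basis - {e} \<Longrightarrow> Suc (size M) = k \<Longrightarrow> d M = d' M"
  shows "cauchy_data e k f c' d'"
  using assms
proof (induction k arbitrary: f c d c' d')
  case 0
  then show ?case by simp
next
  case (Suc k)
  have "cauchy_data e k (pd (real (Suc k)) b f) (\<lambda>M. c' (add_mset b M)) (\<lambda>M. d' (add_mset b M))"
    if "b \<in> Basis - {e}" for b
    by (rule Suc.IH[of _ "\<lambda>M. c (add_mset b M)" "\<lambda>M. d (add_mset b M)"]) (use Suc.prems that in auto)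
  moreover have "cauchy_data e k (pd (real (Suc k)) e f) d' (\<lambda>M. - (\<Sum>b\<in>Basis - {e}. c' (add_mset b (add_mset b M))))"
    by (rule Suc.IH[of _ d "\<lambda>M. - (\<Sum>b\<in>Basis - {e}. c (add_mset b (add_mset b M)))"])
       (use Suc.prems in \<open>auto intro!: sum.cong\<close>)
  ultimately show ?case by simp
qed

lemma cauchy_data_unique:
  fixes e :: "'a::euclidean_space"
  assumes "cauchy_data e k f c d" "cauchy_data e k f c' d'"
  shows "(\<forall>M. set_mset M \<subseteq> Basis - {e} \<longrightarrow> size M = k \<longrightarrow> c M = c' M) \<and>
    (\<forall>M. set_mset M \<subseteq> Basis - {e} \<longrightarrow> Suc (size M) = k \<longrightarrow> d M = d' M)"
  using assms
proof (induction k arbitrary: f c d c' d')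
  case 0
  obtain b :: 'a where "b \<in> Basis" using nonempty_Basis by blast
  then have "norm b = 1" by simp
  moreover have "sphere_const (c {#}) b = sphere_const (c' {#}) b"
    using 0 by (metis cauchy_data.simps(1))
  ultimately show ?case by (simp add: sphere_const_def)
next
  case (Suc k)
  have "c M = c' M" if M: "set_mset M \<subseteq> Basis - {e}" "size M = Suc k" for M
  proof -
    obtain b K where bK: "M = add_mset b K" using M(2) by (metis size_eq_Suc_imp_eq_union)
    then have b: "b \<in> Basis - {e}" using M by simp
    have "cauchy_data e k (pd (real (Suc k)) b f) (\<lambda>M. c (add_mset b M)) (\<lambda>M. d (add_mset b M))"
      "cauchy_data e k (pd (real (Suc k)) b f) (\<lambda>M. c' (add_mset b M)) (\<lambda>M. d' (add_mset b M))"
      using Suc.prems b by auto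
    from Suc.IH[OF this] show ?thesis using M bK by auto
  qed
  moreover have "d M = d' M" if "set_mset M \<subseteq> Basis - {e}" "Suc (size M) = Suc k" for M
  proof -
    have "cauchy_data e k (pd (real (Suc k)) e f) d (\<lambda>M. - (\<Sum>b\<in>Basis - {e}. c (add_mset b (add_mset b M))))"
       "cauchy_data e k (pd (real (Suc k)) e f) d' (\<lambda>M. - (\<Sum>b\<in>Basis - {e}. c' (add_mset b (add_mset b M))))"
      using Suc.prems by auto
    from Suc.IH[OF this] show ?thesis using that by auto
  qed
  ultimately show ?case by blast
qed

lemma cauchy_data_add:
  assumes "e \<in> Basis" "cauchy_data e k f c d" "cauchy_data e k g c' d'" "sphere_fun f" "sphere_fun g"
  shows "cauchy_data e k (\<lambda>x. f x + g x) (\<lambda>M. c M + c' M) (\<lambda>M. d M + d' M)"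
  using assms
proof (induction k arbitrary: f c d g c' d')
  case 0
  then show ?case by (simp add: fun_eq_iff sphere_const_def)
next
  case (Suc k)
  have "cauchy_data e k (\<lambda>x. pd (real (Suc k)) e f x + pd (real (Suc k)) e g x) (\<lambda>M. d M + d' M)
     (\<lambda>M. - (\<Sum>b\<in>Basis - {e}. c (add_mset b (add_mset b M))) + - (\<Sum>b\<in>Basis - {e}. c' (add_mset b (add_mset b M))))"
    by (rule Suc.IH) (use Suc.prems in \<open>auto intro: sphere_fun_pd\<close>)
  moreover have "cauchy_data e k (\<lambda>x. pd (real (Suc k)) b f x + pd (real (Suc k)) b g x)
      (\<lambda>M. c (add_mset b M) + c' (add_mset b M)) (\<lambda>M. d (add_mset b M) + d' (add_mset b M))"
    if "b \<in> Basis - {e}" for b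
    by (rule Suc.IH) (use Suc.prems that in \<open>auto intro: sphere_fun_pd\<close>)
  ultimately show ?case
    by (simp add: pd_fun_add[OF Suc.prems(4,5)] sum.distrib)
qed

lemma cauchy_data_scale:
  assumes "e \<in> Basis" "cauchy_data e k f c d" "sphere_fun f"
  shows "cauchy_data e k (\<lambda>x. r * f x) (\<lambda>M. r * c M) (\<lambda>M. r * d M)"
  using assms
proof (induction k arbitrary: f c d)
  case 0
  then show ?case by (simp add: fun_eq_iff sphere_const_def)
next
  case (Suc k)
  have "cauchy_data e k (\<lambda>x. r * pd (real (Suc k)) e f x) (\<lambda>M. r * d M)
     (\<lambda>M. r * - (\<Sum>b\<in>Basis - {e}. c (add_mset b (add_mset b M))))"
    by (rule Suc.IH) (use Suc.prems in \<open>auto intro: sphere_fun_pd\<close>)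
  moreover have "cauchy_data e k (\<lambda>x. r * pd (real (Suc k)) b f x)
      (\<lambda>M. r * c (add_mset b M)) (\<lambda>M. r * d (add_mset b M))"
    if "b \<in> Basis - {e}" for b
    by (rule Suc.IH) (use Suc.prems that in \<open>auto intro: sphere_fun_pd\<close>)
  ultimately show ?case
    by (simp add: pd_fun_scale[OF Suc.prems(3)] sum_distrib_left)
qed

lemma cauchy_data_0:
  "e \<in> Basis \<Longrightarrow> cauchy_data e k (\<lambda>x. 0) (\<lambda>M. 0) (\<lambda>M. 0)"
  by (induction k) (auto simp: fun_eq_iff sphere_const_def pd_zero[abs_def])

lemma cauchy_data_sum:
  assumes "e \<in> Basis" "\<And>i. i \<in> I \<Longrightarrow> cauchy_data e k (f i) (c i) (d i)" "\<And>i. i \<in> I \<Longrightarrow> sphere_fun (f i)"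
  shows "cauchy_data e k (\<lambda>x. \<Sum>i\<in>I. f i x) (\<lambda>M. \<Sum>i\<in>I. c i M) (\<lambda>M. \<Sum>i\<in>I. d i M)"
  using assms
  by (induction I rule: infinite_finite_induct) (auto intro!: cauchy_data_add sphere_fun_sum simp: cauchy_data_0)

text \<open>All partial derivatives vanish by induction, and in positive degree Euler's identity
  recovers the function from them.\<close>

lemma cauchy_data_eq_0:
  assumes "e \<in> Basis" "f \<in> harm (real k)" "cauchy_data e k f c d"
    and "\<And>M. set_mset M \<subseteq> Basis - {e} \<Longrightarrow> size M = k \<Longrightarrow> c M = 0"
    and "\<And>M. set_mset M \<subseteq> Basis - {e} \<Longrightarrow> Suc (size M) = k \<Longrightarrow> d M = 0"
  shows "f = (\<lambda>x. 0)"
proof -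
  have "cauchy_data e k f (\<lambda>M. 0) (\<lambda>M. 0)"
    using cauchy_data_cong[OF assms(3), of "\<lambda>M. 0" "\<lambda>M. 0"] assms(4,5) by simp
  then show ?thesis using assms(1,2)
  proof (induction k arbitrary: f)
    case 0
    then show ?case by (simp add: fun_eq_iff sphere_const_def)
  next
    case (Suc k)
    have "pd (real (Suc k)) b f = (\<lambda>x. 0)" if b: "b \<in> Basis" for b
      using harm_pd[OF Suc.prems(3) b] Suc.prems(1,2) b by (cases "b = e") (auto intro!: Suc.IH)
    then show ?case using harm_eq_0I[OF Suc.prems(3)] by simp
  qed
qed

lemma cauchy_data_inject:
  assumes e: "e \<in> Basis" and f: "f \<in> harm (real k)" "cauchy_data e k f c d"
    and g: "g \<in> harm (real k)" "cauchy_data e k g c' d'"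
    and eq: "\<And>M. set_mset M \<subseteq> Basis - {e} \<Longrightarrow> size M = k \<Longrightarrow> c M = c' M"
     "\<And>M. set_mset M \<subseteq> Basis - {e} \<Longrightarrow> Suc (size M) = k \<Longrightarrow> d M = d' M"
  shows "f = g"
proof -
  have "(\<lambda>x. f x + (- 1) * g x) = (\<lambda>x. 0)"
  proof (rule cauchy_data_eq_0[OF e])
    show "(\<lambda>x. f x + (- 1) * g x) \<in> harm (real k)" by (intro harm_add f harm_scale g)
    show "cauchy_data e k (\<lambda>x. f x + (- 1) * g x) (\<lambda>M. c M + (- 1) * c' M) (\<lambda>M. d M + (- 1) * d' M)"
      using f g by (intro cauchy_data_add[OF e] cauchy_data_scale[OF e] harm_sphere_fun[OF harm_scale] harm_sphere_fun)
  qed (use eq in auto)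
  then show ?thesis by (simp add: fun_eq_iff)
qed

text \<open>The prospective first derivatives \<open>g b\<close> are supplied by induction with the
  data they must have. That they form a closed, divergence-free field is an equality of functions
  one degree lower, checked on data by \<open>cauchy_data_inject\<close> and
  \<open>cauchy_data_eq_0\<close>; \<open>harm_potential\<close> then integrates the field.\<close>

lemma ex_harm_cauchy_data:
  fixes e :: "'a::euclidean_space"
  assumes e: "e \<in> Basis"
  shows "\<exists>f\<in>harm (real k). cauchy_data e k f c d"
proof (induction k arbitrary: c d)
  case 0
  have "sphere_const (c {#}) \<in> harm 0"
    by (auto simp: harm_def sphere_fun_const lap_def pd_const[abs_def] pd_fun_zero)
  then show ?case by simp
next
  case (Suc k)
  \<comment> \<open>The data that the recursive clause of \<open>cauchy_data\<close> demands of the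
    derivative in direction \<open>b\<close>.\<close>
  let ?C = "\<lambda>b M. if b = e then d M else c (add_mset b M)"
  let ?D = "\<lambda>b M. if b = e then - (\<Sum>a\<in>Basis - {e}. c (add_mset a (add_mset a M))) else d (add_mset b M)"
  have "\<forall>b. \<exists>g. g \<in> harm (real k) \<and> cauchy_data e k g (?C b) (?D b)"
    using Suc.IH by (simp only: Bex_def) blast
  from choice[OF this] obtain g
    where g: "\<And>b. g b \<in> harm (real k)" "\<And>b. cauchy_data e k (g b) (?C b) (?D b)" by auto
  have sg: "sphere_fun (g b)" for b using g(1) harm_sphere_fun by blast
  have ge: "cauchy_data e k (g e) d (\<lambda>M. - (\<Sum>a\<in>Basis - {e}. c (add_mset a (add_mset a M))))"
    using g(2)[of e] by simp
  have gb: "cauchy_data e k (g b) (\<lambda>M. c (add_mset b M)) (\<lambda>M. d (add_mset b M))" if "b \<noteq> e" for b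
    using g(2)[of b] that by simp
  have "(\<forall>a\<in>Basis. \<forall>b\<in>Basis. pd (real k) a (g b) = pd (real k) b (g a)) \<and> (\<lambda>x. \<Sum>b\<in>Basis. pd (real k) b (g b) x) = (\<lambda>x. 0)"
  proof (cases k)
    case 0
    then have "\<exists>c. g b = sphere_const c" for b using g(2)[of b] by auto
    then have "pd (real k) a (g b) = (\<lambda>x. 0)" for a b using pd_const 0 by (metis of_nat_0)
    then show ?thesis by simp
  next
    case (Suc j)
    have h: "pd (real (Suc j)) a (g b) \<in> harm (real j)" if "a \<in> Basis" for a b
      using harm_pd[OF g(1) that, of b] Suc by simp
    have ab: "cauchy_data e j (pd (real (Suc j)) a (g b)) (\<lambda>M. c (add_mset b (add_mset a M))) (\<lambda>M. d (add_mset b (add_mset a M)))"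
      if "a \<in> Basis - {e}" "b \<noteq> e" for a b
      using gb[OF that(2)] that(1) unfolding Suc by simp
    have eb: "cauchy_data e j (pd (real (Suc j)) e (g b)) (\<lambda>M. d (add_mset b M)) (\<lambda>M. - (\<Sum>a\<in>Basis - {e}. c (add_mset b (add_mset a (add_mset a M)))))"
      if "b \<noteq> e" for b
      using gb[OF that(1)] unfolding Suc by simp
    have ae: "cauchy_data e j (pd (real (Suc j)) a (g e)) (\<lambda>M. d (add_mset a M)) (\<lambda>M. - (\<Sum>b\<in>Basis - {e}. c (add_mset b (add_mset b (add_mset a M)))))"
      if "a \<in> Basis - {e}" for a
      using ge that unfolding Suc by simp
    have ee: "cauchy_data e j (pd (real (Suc j)) e (g e)) (\<lambda>M. - (\<Sum>b\<in>Basis - {e}. c (add_mset b (add_mset b M)))) (\<lambda>M. - (\<Sum>b\<in>Basis - {e}. d (add_mset b (add_mset b M))))"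
      using ge unfolding Suc by simp
    \<comment> \<open>The first data coincide, and the second ones differ only in the order of
      insertion into the multiset.\<close>
    have mixed: "pd (real (Suc j)) e (g b) = pd (real (Suc j)) b (g e)" if b: "b \<in> Basis - {e}" for b
      by (rule cauchy_data_inject[OF e h eb h ae])
         (use b e in \<open>auto simp: add_mset_commute\<close>)
    have "pd (real (Suc j)) a (g b) = pd (real (Suc j)) b (g a)" if "a \<in> Basis" "b \<in> Basis" for a b
    proof (cases "a = e \<or> b = e")
      case True
      then show ?thesis using mixed that by (metis DiffI singletonD)
    next
      case False
      show ?thesis
        by (rule cauchy_data_inject[OF e h ab h ab])
           (use False that in \<open>auto simp: add_mset_commute\<close>)
    qed
    \<comment> \<open>The data of the summand for \<open>e\<close> are minus the sum of the data of
      the other summands: this is how the Laplace equation is built into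
      \<open>cauchy_data\<close>.\<close>
    moreover have "(\<lambda>x. \<Sum>b\<in>Basis. pd (real (Suc j)) b (g b) x) = (\<lambda>x. 0)"
    proof (rule cauchy_data_eq_0[OF e])
      show "(\<lambda>x. \<Sum>b\<in>Basis. pd (real (Suc j)) b (g b) x) \<in> harm (real j)"
        by (intro harm_sum h)
      have *: "cauchy_data e j (\<lambda>x. \<Sum>b\<in>Basis. pd (real (Suc j)) b (g b) x)
         (\<lambda>M. \<Sum>b\<in>Basis. if b = e then - (\<Sum>b\<in>Basis - {e}. c (add_mset b (add_mset b M))) else c (add_mset b (add_mset b M)))
         (\<lambda>M. \<Sum>b\<in>Basis. if b = e then - (\<Sum>b\<in>Basis - {e}. d (add_mset b (add_mset b M))) else d (add_mset b (add_mset b M)))"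
      proof (rule cauchy_data_sum[OF e])
        fix b :: 'a assume "b \<in> Basis"
        then show "cauchy_data e j (pd (real (Suc j)) b (g b))
          (\<lambda>M. if b = e then - (\<Sum>b\<in>Basis - {e}. c (add_mset b (add_mset b M))) else c (add_mset b (add_mset b M)))
          (\<lambda>M. if b = e then - (\<Sum>b\<in>Basis - {e}. d (add_mset b (add_mset b M))) else d (add_mset b (add_mset b M)))"
          using ab[of b b] ee by (cases "b = e") simp_all
      qed (intro sphere_fun_pd sg)
      show "cauchy_data e j (\<lambda>x. \<Sum>b\<in>Basis. pd (real (Suc j)) b (g b) x) (\<lambda>M. 0) (\<lambda>M. 0)"
        by (rule cauchy_data_cong[OF *]) (use e in \<open>auto simp: sum.remove[OF _ e]\<close>)
    qed auto
    ultimately show ?thesis using Suc by simp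
  qed
  then obtain f where f: "f \<in> harm (real k + 1)" "\<And>b. b \<in> Basis \<Longrightarrow> pd (real k + 1) b f = g b"
    using harm_potential[of g "real k"] g(1) by (auto simp: fun_eq_iff)
  then have "cauchy_data e (Suc k) f c d" using ge gb e by (simp add: add.commute)
  then show ?case using f(1) by (auto simp: add.commute)
qed

text \<open>The data of \<open>f\<close> are assembled from those of its first derivatives. Their
  compatibility follows from \<open>cauchy_data_unique\<close> for second derivatives: symmetry
  gives \<open>swap\<close> and \<open>dd\<close>, and the Laplace equation gives \<open>ee\<close>.
  The induction starts because degree 0 contains only constants.\<close>

lemma harm_has_cauchy_data:
  fixes e :: "'a::euclidean_space"
  assumes N: "2 \<le> DIM('a)" and e: "e \<in> Basis"
  shows "f \<in> harm (real k) \<Longrightarrow> \<exists>c d. cauchy_data e k f c d"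
proof (induction k arbitrary: f)
  case 0
  then obtain r where "f = sphere_const r" using harm_0_constant[OF N] by auto
  then have "cauchy_data e 0 f (\<lambda>M. r) (\<lambda>M. 0)" by simp
  then show ?case by blast
next
  case (Suc k)
  let ?p = "\<lambda>b. pd (real (Suc k)) b f"
  have sf: "sphere_fun f" using Suc.prems by (rule harm_sphere_fun)
  have h: "?p b \<in> harm (real k)" if "b \<in> Basis" for b using harm_pd[OF Suc.prems that] by simp
  then have "\<forall>b\<in>Basis. \<exists>c d. cauchy_data e k (?p b) c d" using Suc.IH by blast
  then obtain C D where CD: "\<And>b. b \<in> Basis \<Longrightarrow> cauchy_data e k (?p b) (C b) (D b)" by metis
  have comm: "pd (real k) a (?p b) = pd (real k) b (?p a)" if "a \<in> Basis" "b \<in> Basis" for a b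
    using pd_commute[OF sf that, of "real (Suc k)"] by simp
  \<comment> \<open>Both numbers are data of the same second derivative, in directions
    \<open>a\<close> and \<open>b\<close>.\<close>
  have swap: "C a (add_mset b K) = C b (add_mset a K)"
    if ab: "a \<in> Basis - {e}" "b \<in> Basis - {e}" and K: "set_mset K \<subseteq> Basis - {e}" "Suc (size K) = k" for a b K
  proof -
    obtain j where j: "k = Suc j" using K(2) by (cases k) auto
    have eq: "pd (real k) a (?p b) = pd (real k) b (?p a)" using comm ab by auto
    have 1: "cauchy_data e j (pd (real k) b (?p a)) (\<lambda>M. C a (add_mset b M)) (\<lambda>M. D a (add_mset b M))"
      using CD[of a] ab unfolding j by auto
    have 2: "cauchy_data e j (pd (real k) b (?p a)) (\<lambda>M. C b (add_mset a M)) (\<lambda>M. D b (add_mset a M))"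
      unfolding eq[symmetric] using CD[of b] ab unfolding j by auto
    show ?thesis using conjunct1[OF cauchy_data_unique[OF 1 2], THEN spec, of K] K j by simp
  qed
  \<comment> \<open>An arbitrary element of \<open>M\<close> is taken as the first direction;
    \<open>swap\<close> makes the value independent of this choice.\<close>
  define c where "c M = (let b = SOME b. b \<in># M in C b (M - {#b#}))" for M
  have c: "c (add_mset b M) = C b M" if b: "b \<in> Basis - {e}" and M: "set_mset M \<subseteq> Basis - {e}" "size M = k" for b M
  proof -
    define a where "a = (SOME a. a \<in># add_mset b M)"
    have a: "a \<in># add_mset b M" unfolding a_def by (rule someI[of _ b]) simp
    have cC: "c (add_mset b M) = C a (add_mset b M - {#a#})" unfolding c_def a_def[symmetric] by simp
    show ?thesis
    proof (cases "a = b")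
      case False
      then have "a \<in># M" using a by simp
      then obtain K where K: "M = add_mset a K" by (metis insert_DiffM)
      then have "c (add_mset b M) = C a (add_mset b K)" using cC by (simp add: add_mset_commute)
      then show ?thesis using swap[of a b K] M b K by auto
    qed (use cC in simp)
  qed
  have dd: "D b M = C e (add_mset b M)"
    if b: "b \<in> Basis - {e}" and M: "set_mset M \<subseteq> Basis - {e}" "Suc (size M) = k" for b M
  proof -
    obtain j where j: "k = Suc j" using M(2) by (cases k) auto
    have eq: "pd (real k) b (?p e) = pd (real k) e (?p b)" using comm b e by auto
    have 1: "cauchy_data e j (pd (real k) e (?p b)) (\<lambda>M. C e (add_mset b M)) (\<lambda>M. D e (add_mset b M))"
      unfolding eq[symmetric] using CD[OF e] b unfolding j by auto
    have 2: "cauchy_data e j (pd (real k) e (?p b)) (D b) (\<lambda>M. - (\<Sum>a\<in>Basis - {e}. C b (add_mset a (add_mset a M))))"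
      using CD[of b] b unfolding j by auto
    show ?thesis using conjunct1[OF cauchy_data_unique[OF 1 2], THEN spec, of M] M j by simp
  qed
  have ee: "D e M = - (\<Sum>b\<in>Basis - {e}. c (add_mset b (add_mset b M)))"
    if M: "set_mset M \<subseteq> Basis - {e}" "Suc (size M) = k" for M
  proof -
    obtain j where j: "k = Suc j" using M(2) by (cases k) auto
    have pp: "cauchy_data e j (pd (real k) b (?p b)) (if b = e then D e else (\<lambda>M. C b (add_mset b M)))
       (if b = e then (\<lambda>M. - (\<Sum>a\<in>Basis - {e}. C e (add_mset a (add_mset a M)))) else (\<lambda>M. D b (add_mset b M)))"
      if b: "b \<in> Basis" for b
      using CD[of b] b unfolding j by auto
    have z: "(\<lambda>x. \<Sum>b\<in>Basis. pd (real k) b (?p b) x) = (\<lambda>x. 0)"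
      by (rule sphere_fun_eqI) (use Suc.prems in \<open>auto simp: harm_def lap_def intro!: sphere_fun_sum sphere_fun_pd\<close>)
    have "cauchy_data e j (\<lambda>x. 0) (\<lambda>M. \<Sum>b\<in>Basis. (if b = e then D e else (\<lambda>M. C b (add_mset b M))) M)
      (\<lambda>M. \<Sum>b\<in>Basis. (if b = e then (\<lambda>M. - (\<Sum>a\<in>Basis - {e}. C e (add_mset a (add_mset a M)))) else (\<lambda>M. D b (add_mset b M))) M)"
      unfolding z[symmetric] by (rule cauchy_data_sum[OF e pp]) (simp_all add: sf sphere_fun_pd)
    from cauchy_data_unique[OF this cauchy_data_0[OF e]]
    have "(\<Sum>b\<in>Basis. (if b = e then D e else (\<lambda>M. C b (add_mset b M))) M) = 0"
      using M j by simp
    moreover have "(\<Sum>b\<in>Basis - {e}. (if b = e then D e else (\<lambda>M. C b (add_mset b M))) M) = (\<Sum>b\<in>Basis - {e}. c (add_mset b (add_mset b M)))"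
      using M by (intro sum.cong refl) (auto simp: c)
    ultimately show ?thesis by (simp add: sum.remove[OF _ e])
  qed
  \<comment> \<open>The second datum of \<open>f\<close> is the first datum of its derivative in
    direction \<open>e\<close>.\<close>
  have "cauchy_data e (Suc k) f c (C e)"
    unfolding cauchy_data.simps
  proof (intro conjI ballI)
    fix b assume b: "b \<in> Basis - {e}"
    show "cauchy_data e k (?p b) (\<lambda>M. c (add_mset b M)) (\<lambda>M. C e (add_mset b M))"
      by (rule cauchy_data_cong[OF CD]) (use b c dd in auto)
  next
    show "cauchy_data e k (?p e) (C e) (\<lambda>M. - (\<Sum>b\<in>Basis - {e}. c (add_mset b (add_mset b M))))"
      by (rule cauchy_data_cong[OF CD[OF e]]) (use ee in auto)
  qed
  then show ?case by blast
qed

text \<open>Passes from an indexed family to the set required by \<open>has_dimension\<close>.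
  Independence over indices forces \<open>\<phi>\<close> to be injective, since two equal members
  would satisfy a relation with coefficients 1 and -1.\<close>

lemma has_dimensionI:
  fixes \<phi> :: "'i \<Rightarrow> 'a \<Rightarrow> real"
  assumes I: "finite I"
    and V: "\<And>u. (\<lambda>x. \<Sum>i\<in>I. u i * \<phi> i x) \<in> V"
    and span: "\<And>f. f \<in> V \<Longrightarrow> \<exists>u. f = (\<lambda>x. \<Sum>i\<in>I. u i * \<phi> i x)"
    and indep: "\<And>u i. (\<lambda>x. \<Sum>i\<in>I. u i * \<phi> i x) = (\<lambda>x. 0) \<Longrightarrow> i \<in> I \<Longrightarrow> u i = 0"
  shows "has_dimension V (card I)"
proof -
  have inj: "inj_on \<phi> I"
  proof (rule inj_onI, rule ccontr)
    fix i j assume ij: "i \<in> I" "j \<in> I" "\<phi> i = \<phi> j" "i \<noteq> j"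
    define u where "u l = (if l = i then 1 else if l = j then -1 else (0::real))" for l
    have "(\<Sum>l\<in>I. u l * \<phi> l x) = (\<Sum>l\<in>{i, j}. u l * \<phi> l x)" for x
      by (rule sum.mono_neutral_right) (use ij I in \<open>auto simp: u_def\<close>)
    then have "u i = 0" using ij by (intro indep[of u i]) (auto simp: u_def)
    then show False by (simp add: u_def)
  qed
  have fs: "(\<Sum>f\<in>F. (\<lambda>x. c f * f x)) = (\<lambda>x. \<Sum>f\<in>F. c f * f x)" for F :: "('a \<Rightarrow> real) set" and c
    by (induction F rule: infinite_finite_induct) (auto simp: zero_fun_def plus_fun_def)
  have re: "(\<lambda>x. \<Sum>f\<in>\<phi> ` I. c f * f x) = (\<lambda>x. \<Sum>i\<in>I. c (\<phi> i) * \<phi> i x)" for c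
    by (simp add: sum.reindex[OF inj])
  have span_eq: "fun_space.span (\<phi> ` I) = range (\<lambda>c x. \<Sum>f\<in>\<phi> ` I. c f * f x)"
    using I by (simp add: fun_space.span_finite fs)
  have "fun_space.span (\<phi> ` I) = V"
  proof (intro equalityI subsetI)
    fix f assume "f \<in> fun_space.span (\<phi> ` I)"
    then show "f \<in> V" using V by (auto simp: span_eq re)
  next
    fix f assume "f \<in> V"
    then obtain u where "f = (\<lambda>x. \<Sum>i\<in>I. u i * \<phi> i x)" using span by blast
    also have "\<dots> = (\<lambda>x. \<Sum>f\<in>\<phi> ` I. u (the_inv_into I \<phi> f) * f x)"
      unfolding re using inj by (intro ext sum.cong) (auto simp: the_inv_into_f_f)
    finally show "f \<in> fun_space.span (\<phi> ` I)" 
      unfolding span_eq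
      by (intro range_eqI[where f="\<lambda>c x. \<Sum>f\<in>\<phi> ` I. c f * f x" and x="\<lambda>f. u (the_inv_into I \<phi> f)"])
  qed
  moreover have "fun_space.independent (\<phi> ` I)"
  proof (rule fun_space.independent_if_scalars_zero)
    fix u v assume z: "(\<Sum>f\<in>\<phi> ` I. (\<lambda>x. u f * f x)) = 0" and "v \<in> \<phi> ` I"
    then obtain i where i: "i \<in> I" "v = \<phi> i" by auto
    have "(\<lambda>x. \<Sum>i\<in>I. u (\<phi> i) * \<phi> i x) = (\<lambda>x. 0)"
      using z unfolding fs re zero_fun_def .
    from indep[OF this i(1)] i(2) show "u v = 0" by simp
  qed (use I in simp)
  ultimately show ?thesis
    unfolding has_dimension_def using I card_image[OF inj] by blast
qed

text \<open>The basis is dual to the Cauchy data: each \<open>\<phi> i\<close> has one datum equal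
  to 1 and all others 0. \<open>Inl\<close> indexes the data without \<open>e\<close>,
  \<open>Inr\<close> those with one derivative along \<open>e\<close>.\<close>

lemma has_dimension_harm:
  fixes e :: "'a::euclidean_space"
  assumes N: "2 \<le> DIM('a)" and e: "e \<in> Basis"
  defines "A \<equiv> Basis - {e}"
  shows "has_dimension (harm (real k) :: ('a \<Rightarrow> real) set)
     (card {M. set_mset M \<subseteq> A \<and> size M = k} + card {M. set_mset M \<subseteq> A \<and> Suc (size M) = k})"
proof -
  let ?I1 = "{M. set_mset M \<subseteq> A \<and> size M = k}" and ?I2 = "{M. set_mset M \<subseteq> A \<and> Suc (size M) = k}"
  have "finite (multisets_of_size A j)" for j by (auto simp: A_def)
  moreover have "?I1 = multisets_of_size A k" "?I2 \<subseteq> multisets_of_size A (k - 1)"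
    by (auto simp: multisets_of_size_def)
  ultimately have fin: "finite ?I1" "finite ?I2"
    using finite_subset[of ?I2 "multisets_of_size A (k - 1)"] by simp_all
  define I where "I = ?I1 <+> ?I2"
  have finI: "finite I" using fin by (simp add: I_def)
  have memI: "Inl M \<in> I \<longleftrightarrow> set_mset M \<subseteq> A \<and> size M = k" "Inr M \<in> I \<longleftrightarrow> set_mset M \<subseteq> A \<and> Suc (size M) = k" for M
    by (auto simp: I_def)
  let ?c = "\<lambda>i M. if i = Inl M then 1 else (0::real)" and ?d = "\<lambda>i M. if i = Inr M then 1 else (0::real)"
  have "\<forall>i. \<exists>f. f \<in> harm (real k) \<and> cauchy_data e k f (?c i) (?d i)"
    using ex_harm_cauchy_data[OF e] by (simp only: Bex_def) blast
  from choice[OF this] obtain \<phi>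
    where \<phi>: "\<And>i. \<phi> i \<in> harm (real k)" "\<And>i. cauchy_data e k (\<phi> i) (?c i) (?d i)" by auto
  have comb: "(\<lambda>x. \<Sum>i\<in>I. u i * \<phi> i x) \<in> harm (real k)" for u
    by (intro harm_sum harm_scale \<phi>)
  have data: "cauchy_data e k (\<lambda>x. \<Sum>i\<in>I. u i * \<phi> i x) (\<lambda>M. u (Inl M)) (\<lambda>M. u (Inr M))" for u
  proof -
    have "cauchy_data e k (\<lambda>x. \<Sum>i\<in>I. u i * \<phi> i x) (\<lambda>M. \<Sum>i\<in>I. u i * ?c i M) (\<lambda>M. \<Sum>i\<in>I. u i * ?d i M)"
      by (intro cauchy_data_sum e cauchy_data_scale \<phi> sphere_fun_scale harm_sphere_fun[OF \<phi>(1)])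
    then show ?thesis
      by (rule cauchy_data_cong) (use finI memI in \<open>auto simp: A_def if_distrib cong: if_cong\<close>)
  qed
  have "has_dimension (harm (real k) :: ('a \<Rightarrow> real) set) (card I)"
  proof (rule has_dimensionI[OF finI, of \<phi>])
    fix f :: "'a \<Rightarrow> real" assume f: "f \<in> harm (real k)"
    then obtain c d where cd: "cauchy_data e k f c d" using harm_has_cauchy_data[OF N e] by blast
    \<comment> \<open>The coordinates of \<open>f\<close> in this basis are its own Cauchy
      data.\<close>
    have "f = (\<lambda>x. \<Sum>i\<in>I. case_sum c d i * \<phi> i x)"
      by (rule cauchy_data_inject[OF e f cd comb data]) auto
    then show "\<exists>u. f = (\<lambda>x. \<Sum>i\<in>I. u i * \<phi> i x)" by blast
  next
    fix u i assume z: "(\<lambda>x. \<Sum>i\<in>I. u i * \<phi> i x) = (\<lambda>x. 0)" and i: "i \<in> I"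
    have "cauchy_data e k (\<lambda>x. 0) (\<lambda>M. u (Inl M)) (\<lambda>M. u (Inr M))" using data[of u] unfolding z .
    from cauchy_data_unique[OF this cauchy_data_0[OF e]] i memI
    show "u i = 0" by (cases i) (auto simp: A_def)
  qed (rule comb)
  moreover have "card I = card ?I1 + card ?I2"
    using fin unfolding I_def by (simp add: card_Plus)
  ultimately show ?thesis by simp
qed

section \<open>The counting function\<close>

lemma has_dimension_unique:
  assumes "has_dimension V a" "has_dimension V b"
  shows "a = b"
  using assms unfolding has_dimension_def
  by (metis fun_space.dim_span_eq_card_independent)

lemma has_dimension_0: "has_dimension {\<lambda>x. 0} 0"
  unfolding has_dimension_def
  by (intro exI[of _ "{}"]) (auto simp: fun_space.independent_empty zero_fun_def)

lemma eigenspace_sphere_fun: "f \<in> eigenspace \<mu> \<Longrightarrow> sphere_fun f"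
  by (simp add: eigenspace_def sphere_fun_def)

lemma zero_mem_eigenspace: "(\<lambda>x. 0) \<in> eigenspace \<mu>"
  using harm_sphere_fun[OF harm_0] harm_0[of 0]
  by (auto simp: eigenspace_def sphere_fun_def harm_def sphere_laplacian_eq)

text \<open>Negative numbers fall to the maximum principle directly; any other number is the
  eigenvalue of a degree \<open>t \<ge> 0\<close>, which is not an integer by assumption.\<close>

lemma eigenspace_eq_trivial:
  fixes \<mu> :: real
  assumes N: "2 \<le> DIM('a::euclidean_space)" and \<mu>: "\<And>k::nat. \<mu> \<noteq> real k * (real k + real DIM('a) - 2)"
  shows "(eigenspace \<mu> :: ('a \<Rightarrow> real) set) = {\<lambda>x. 0}"
proof -
  have "f = (\<lambda>x. 0)" if f: "f \<in> eigenspace \<mu>" for f :: "'a \<Rightarrow> real"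
  proof (cases "\<mu> < 0")
    case True
    have sf: "sphere_fun f" using f by (rule eigenspace_sphere_fun)
    show ?thesis
    proof (rule eq_0_of_lap_0_eq_pos[OF sf])
      show "0 < - \<mu>" using True by simp
      show "lap 0 f x = - \<mu> * f x" if "norm x = 1" for x
        using f that sphere_laplacian_eq[OF sf that] by (simp add: eigenspace_def)
    qed
  next
    case False
    define m where "m = real DIM('a) - 2"
    have m: "m \<ge> 0" using N by (simp add: m_def)
    \<comment> \<open>The larger root of \<open>t * (t + m) = \<mu>\<close>.\<close>
    define t where "t = (sqrt (m\<^sup>2 + 4 * \<mu>) - m) / 2"
    have "(sqrt (m\<^sup>2 + 4 * \<mu>))\<^sup>2 = m\<^sup>2 + 4 * \<mu>" using False by simp
    moreover have sq: "sqrt (m\<^sup>2 + 4 * \<mu>) = 2 * t + m" by (simp add: t_def field_simps)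
    ultimately have \<mu>t: "\<mu> = t * (t + m)" unfolding sq by (simp add: power2_eq_square algebra_simps)
    have "sqrt (m\<^sup>2 + 4 * \<mu>) \<ge> m" using False m by (intro real_le_rsqrt) simp
    then have t0: "t \<ge> 0" by (simp add: t_def)
    define k where "k = nat \<lfloor>t\<rfloor>"
    have k: "real k \<le> t" "t < real k + 1"
      unfolding k_def using t0 by linarith+
    have "real k \<noteq> t" using \<mu>[of k] \<mu>t by (auto simp: m_def algebra_simps)
    then have "real k < t" using k by simp
    moreover have "f \<in> harm t"
      using f eigenspace_eq_harm[of t, where ?'a='a] \<mu>t by (simp add: m_def algebra_simps)
    ultimately show ?thesis using harm_eq_0_of_nonint[OF N _ _ k(2)] by blast
  qed
  then show ?thesis using zero_mem_eigenspace by blast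
qed

text \<open>The numbers of monomials of degrees \<open>k\<close> and \<open>k - 1\<close> in
  \<open>n\<close> variables. At \<open>k = 0\<close> truncated subtraction would make the second
  binomial 1 instead of 0, hence the case split.\<close>

definition sphere_mult :: "nat \<Rightarrow> nat \<Rightarrow> nat" where
  "sphere_mult n k = (n + k - 1 choose k) + (if k = 0 then 0 else n + k - 2 choose (k - 1))"

definition sphere_lambda :: "nat \<Rightarrow> nat \<Rightarrow> real" where
  "sphere_lambda n k = real k * (real k + real n - 1)"

lemma has_dimension_eigenspace:
  assumes N: "DIM('a::euclidean_space) = Suc n" and n: "n \<ge> 1"
  shows "has_dimension (eigenspace (sphere_lambda n k) :: ('a \<Rightarrow> real) set) (sphere_mult n k)"
proof -
  obtain e :: 'a where e: "e \<in> Basis" using nonempty_Basis by blast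
  have A: "card (Basis - {e}) = n" using e N by simp
  have "{M. set_mset M \<subseteq> Basis - {e} \<and> size M = j} = multisets_of_size (Basis - {e}) j" for j
    by (auto simp: multisets_of_size_def)
  then have 1: "card {M. set_mset M \<subseteq> Basis - {e} \<and> size M = j} = n + j - 1 choose j" for j
    using A by (simp add: card_multisets_of_size)
  have 2: "card {M. set_mset M \<subseteq> Basis - {e} \<and> Suc (size M) = k} = (if k = 0 then 0 else n + k - 2 choose (k - 1))"
    using 1[of "k - 1"] n by (cases k) auto
  have "eigenspace (sphere_lambda n k) = (harm (real k) :: ('a \<Rightarrow> real) set)"
    using eigenspace_eq_harm[of "real k", where ?'a='a] N by (simp add: sphere_lambda_def algebra_simps)
  then show ?thesis
    using has_dimension_harm[OF _ e, of k] N n unfolding sphere_mult_def 1 2 by simp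
qed

lemma has_dimension_eigenspace_other:
  assumes N: "DIM('a::euclidean_space) = Suc n" and n: "n \<ge> 1" and \<mu>: "\<mu> \<notin> range (sphere_lambda n)"
  shows "has_dimension (eigenspace \<mu> :: ('a \<Rightarrow> real) set) 0"
proof -
  have "\<mu> \<noteq> real k * (real k + real DIM('a) - 2)" for k
    using \<mu> N by (auto simp: sphere_lambda_def image_iff algebra_simps)
  then have "(eigenspace \<mu> :: ('a \<Rightarrow> real) set) = {\<lambda>x. 0}" by (intro eigenspace_eq_trivial) (use N n in auto)
  then show ?thesis by (simp add: has_dimension_0)
qed

lemma strict_mono_sphere_lambda:
  assumes "n \<ge> 1" shows "strict_mono (sphere_lambda n)"
proof (rule strict_monoI_Suc)
  fix k
  have "sphere_lambda n (Suc k) - sphere_lambda n k = 2 * real k + real n"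
    by (simp add: sphere_lambda_def algebra_simps)
  then show "sphere_lambda n k < sphere_lambda n (Suc k)" using assms by simp
qed

text \<open>\<open>sphere_eigenvalue\<close> is chosen among all listings, so one has to be
  constructed: each \<open>l k\<close> repeated \<open>m k\<close> times.\<close>

lemma ex_listing:
  fixes l :: "nat \<Rightarrow> real" and m :: "nat \<Rightarrow> nat"
  assumes l: "strict_mono l" and m: "\<And>k. m k > 0"
  shows "\<exists>ev :: nat \<Rightarrow> real. mono ev \<and> (\<forall>k. finite {i. ev i = l k} \<and> card {i. ev i = l k} = m k) \<and> range ev \<subseteq> range l"
proof -
  define S where "S k = (\<Sum>j<k. m j)" for k
  have S: "strict_mono S" using m by (intro strict_monoI_Suc) (simp add: S_def)
  \<comment> \<open>The number of the block containing position \<open>i\<close>; block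
    \<open>k\<close> occupies the positions from \<open>S k\<close> up to, but excluding,
    \<open>S (Suc k)\<close>.\<close>
  define L where "L i = (LEAST k. i < S (Suc k))" for i
  have ex: "\<exists>k. i < S (Suc k)" for i
    using seq_suble[OF S, of "Suc i"] by (intro exI[of _ i]) simp
  have L1: "i < S (Suc (L i))" for i unfolding L_def by (rule LeastI_ex[OF ex])
  have L2: "L i \<le> k" if "i < S (Suc k)" for i k unfolding L_def using that by (rule Least_le)
  have monoL: "L i \<le> L j" if "i \<le> j" for i j
    using L2[of i "L j"] L1[of j] that by simp
  have fib: "{i. L i = k} = {S k..<S (Suc k)}" for k
  proof (intro equalityI subsetI)
    fix i assume "i \<in> {i. L i = k}"
    then have k: "L i = k" by simp
    have "S k \<le> i"
    proof (cases k)
      case 0 then show ?thesis by (simp add: S_def)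
    next
      case (Suc j) then show ?thesis using L2[of i j] k by (metis not_less not_less_eq_eq order_refl)
    qed
    then show "i \<in> {S k..<S (Suc k)}" using L1[of i] k by simp
  next
    fix i assume i: "i \<in> {S k..<S (Suc k)}"
    then have "L i \<le> k" by (intro L2) simp
    moreover have "\<not> L i < k"
    proof
      assume "L i < k"
      then have "S (Suc (L i)) \<le> S k" using S by (simp add: strict_mono_less_eq)
      then show False using L1[of i] i by simp
    qed
    ultimately show "i \<in> {i. L i = k}" by simp
  qed
  show ?thesis
  proof (intro exI[of _ "\<lambda>i. l (L i)"] conjI allI)
    show "mono (\<lambda>i. l (L i))"
      using monoL l by (intro monoI) (simp add: strict_mono_less_eq)
    show "finite {i. l (L i) = l k}" "card {i. l (L i) = l k} = m k" for k
      using l by (simp_all add: strict_mono_eq fib) (simp add: S_def)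
  qed auto
qed

text \<open>Dimensions are unique, so every listing has the same fibres up to position, and the
  count does not depend on the chosen one.\<close>

lemma sphere_counting_eq:
  fixes n :: nat
  assumes n: "n = CARD('n::finite)"
  shows "sphere_counting TYPE('n) x = (\<Sum>k | sphere_lambda n k \<le> x. real (sphere_mult n k))"
proof -
  have n1: "n \<ge> 1" using n by (simp add: Suc_leI)
  have N: "DIM('n ambient) = Suc n" using n by simp
  have mono: "strict_mono (sphere_lambda n)" using n1 by (rule strict_mono_sphere_lambda)
  have pos: "sphere_mult n k > 0" for k using n1 by (cases k) (simp_all add: sphere_mult_def)
  note dim = has_dimension_eigenspace[OF N n1] and dim0 = has_dimension_eigenspace_other[OF N n1]
  have ex: "\<exists>ev. lists_eigenvalues TYPE('n) ev"
  proof -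
    obtain ev :: "nat \<Rightarrow> real" where ev: "mono ev" "\<And>k. finite {i. ev i = sphere_lambda n k} \<and> card {i. ev i = sphere_lambda n k} = sphere_mult n k"
       "range ev \<subseteq> range (sphere_lambda n)"
      using ex_listing[OF mono, of "sphere_mult n", OF pos] by auto
    have "finite {k. ev k = \<mu>} \<and> has_dimension (eigenspace \<mu> :: ('n ambient \<Rightarrow> real) set) (card {k. ev k = \<mu>})" for \<mu>
    proof (cases "\<mu> \<in> range (sphere_lambda n)")
      case True
      then show ?thesis using ev(2) dim by auto
    next
      case False
      then have "{k. ev k = \<mu>} = {}" using ev(3) by auto
      then show ?thesis using dim0[OF False] by simp
    qed
    then show ?thesis using ev(1) unfolding lists_eigenvalues_def by blast
  qed
  define ev where "ev = sphere_eigenvalue TYPE('n)"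
  have "lists_eigenvalues TYPE('n) ev"
    unfolding ev_def sphere_eigenvalue_def using ex by (rule someI_ex)
  then have fin: "finite {i. ev i = \<mu>}"
    and d: "has_dimension (eigenspace \<mu> :: ('n ambient \<Rightarrow> real) set) (card {i. ev i = \<mu>})" for \<mu>
    unfolding lists_eigenvalues_def by auto
  have card: "card {i. ev i = sphere_lambda n k} = sphere_mult n k" for k
    using has_dimension_unique[OF d dim] .
  have "ev i \<in> range (sphere_lambda n)" for i
  proof (rule ccontr)
    assume "ev i \<notin> range (sphere_lambda n)"
    from has_dimension_unique[OF d dim0[OF this]] have "{j. ev j = ev i} = {}" using fin by simp
    then show False by auto
  qed
  then have eq: "{i. ev i \<le> x} = (\<Union>k\<in>{k. sphere_lambda n k \<le> x}. {i. ev i = sphere_lambda n k})"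
    by auto (metis imageE)
  have "{k. sphere_lambda n k \<le> x} \<subseteq> {..nat \<lceil>x\<rceil>}"
  proof
    fix k assume "k \<in> {k. sphere_lambda n k \<le> x}"
    moreover have "real k \<le> sphere_lambda n k"
    proof (cases "k = 0")
      case False
      then have "real k * 1 \<le> real k * (real k + real n - 1)" using n1 by (intro mult_left_mono) auto
      then show ?thesis by (simp add: sphere_lambda_def)
    qed (simp add: sphere_lambda_def)
    ultimately have "real k \<le> x" by simp
    then show "k \<in> {..nat \<lceil>x\<rceil>}" by (simp; linarith)
  qed
  then have finK: "finite {k. sphere_lambda n k \<le> x}" using finite_subset by blast
  have "card {i. ev i \<le> x} = (\<Sum>k | sphere_lambda n k \<le> x. card {i. ev i = sphere_lambda n k})"
    unfolding eq using finK fin strict_mono_eq[OF mono] by (subst card_UN_disjoint) auto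
  then show ?thesis unfolding sphere_counting_def ev_def[symmetric] by (simp add: card)
qed

text \<open>The two binomials count the monomials of degree at most \<open>K\<close> and at most
  \<open>K - 1\<close> in \<open>n\<close> variables. After passing to the complementary lower index
  \<open>p\<close>, the induction step is Pascal's rule applied twice.\<close>

lemma sum_sphere_mult:
  assumes "n = Suc p"
  shows "(\<Sum>k\<le>K. sphere_mult n k) = (p + K + 1 choose Suc p) + (p + K choose Suc p)"
proof (induction K)
  case 0
  then show ?case using assms by (simp add: sphere_mult_def)
next
  case (Suc K)
  have "p + Suc K choose Suc K = p + Suc K choose p" "p + K choose K = p + K choose p"
    using binomial_symmetric[of "Suc K" "p + Suc K"] binomial_symmetric[of K "p + K"] by simp_all
  then have "sphere_mult n (Suc K) = (p + Suc K choose p) + (p + K choose p)"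
    using assms by (simp add: sphere_mult_def)
  then show ?case using Suc by simp
qed

text \<open>The two rising products share the factors K + 1, ..., K + n - 1; the remaining ones, K +
  n and K, add up to 2 K + n.\<close>

lemma real_sum_sphere_mult:
  assumes "n \<ge> 1"
  shows "(\<Sum>k\<le>K. real (sphere_mult n k)) = (2 * real K + real n) * pochhammer (real K + 1) (n - 1) / fact n"
proof -
  obtain p where p: "n = Suc p" using assms by (cases n) auto
  have a: "real (p + K + 1 choose Suc p) = pochhammer (real K + 1) (Suc p) / fact (Suc p)"
    unfolding binomial_gbinomial gbinomial_pochhammer' by (simp add: algebra_simps)
  have b: "real (p + K choose Suc p) = pochhammer (real K) (Suc p) / fact (Suc p)"
    unfolding binomial_gbinomial gbinomial_pochhammer' by (simp add: algebra_simps)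
  have "(\<Sum>k\<le>K. real (sphere_mult n k)) = (pochhammer (real K + 1) (Suc p) + pochhammer (real K) (Suc p)) / fact (Suc p)"
    unfolding add_divide_distrib a[symmetric] b[symmetric] of_nat_sum[symmetric] sum_sphere_mult[OF p] by simp
  also have "pochhammer (real K + 1) (Suc p) + pochhammer (real K) (Suc p) = (2 * real K + real n) * pochhammer (real K + 1) p"
    unfolding pochhammer_rec'[of "real K + 1"] pochhammer_rec[of "real K"] p by (simp add: algebra_simps)
  finally show ?thesis using p by simp
qed

lemma sphere_counting_between:
  assumes n: "n = CARD('n::finite)" and x: "sphere_lambda n K \<le> x" "x < sphere_lambda n (Suc K)"
  shows "sphere_counting TYPE('n) x = (2 * real K + real n) * pochhammer (real K + 1) (n - 1) / fact n"
proof -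
  have n1: "n \<ge> 1" using n by (simp add: Suc_leI)
  have mono: "strict_mono (sphere_lambda n)" using n1 by (rule strict_mono_sphere_lambda)
  have "{k. sphere_lambda n k \<le> x} = {..K}"
  proof (intro equalityI subsetI)
    fix k assume "k \<in> {k. sphere_lambda n k \<le> x}"
    then have "sphere_lambda n k < sphere_lambda n (Suc K)" using x by simp
    then show "k \<in> {..K}" using mono by (simp add: strict_mono_less)
  next
    fix k assume "k \<in> {..K}"
    then have "sphere_lambda n k \<le> sphere_lambda n K" using mono by (simp add: strict_mono_less_eq)
    then show "k \<in> {k. sphere_lambda n k \<le> x}" using x by simp
  qed
  then show ?thesis using sphere_counting_eq[OF n] real_sum_sphere_mult[OF n1] by simp
qed

section \<open>The Weyl function\<close>

lemma stereo_has_derivative: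
  fixes u :: "real ^ 'n::finite"
  defines "c \<equiv> 1 / (1 + (norm u)\<^sup>2)"
  shows "(stereo has_derivative
    (\<lambda>h. ((2 * c) *\<^sub>R h - (4 * c\<^sup>2 * (u \<bullet> h)) *\<^sub>R u, 4 * c\<^sup>2 * (u \<bullet> h)))) (at u)"
proof -
  have p: "1 + u \<bullet> u \<noteq> 0" by (smt (verit) inner_ge_zero)
  have c: "c = 1 / (1 + u \<bullet> u)" by (simp add: c_def power2_norm_eq_inner)
  have st: "stereo = (\<lambda>u::real^'n. (1 / (1 + u \<bullet> u)) *\<^sub>R (2 *\<^sub>R u, u \<bullet> u - 1))"
    by (simp add: stereo_def fun_eq_iff power2_norm_eq_inner)
  have "(stereo has_derivative (\<lambda>h. c *\<^sub>R (2 *\<^sub>R h, 2 * (u \<bullet> h)) + (- 2 * c\<^sup>2 * (u \<bullet> h)) *\<^sub>R (2 *\<^sub>R u, u \<bullet> u - 1))) (at u)"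
    unfolding st
    by (rule derivative_eq_intros refl | use p in \<open>simp; fail\<close>)+
      (simp add: fun_eq_iff c power2_eq_square inner_commute divide_simps p)
  moreover have "c * 2 * (u \<bullet> h) + (- 2 * c\<^sup>2 * (u \<bullet> h)) * (u \<bullet> u - 1) = 4 * c\<^sup>2 * (u \<bullet> h)" for h
    using p by (simp add: c power2_eq_square divide_simps) (simp add: algebra_simps)
  ultimately show ?thesis
    by (elim has_derivative_eq_rhs) (simp add: fun_eq_iff algebra_simps)
qed

text \<open>Stereographic projection is conformal: the terms of the Gram matrix involving
  \<open>u \<bullet> h\<close> and \<open>u \<bullet> k\<close> cancel because
  \<open>c * (1 + u \<bullet> u) = 1\<close>.\<close>

lemma stereo_metric_eq:
  fixes u :: "real ^ 'n::finite"
  shows "stereo_metric u = (\<chi> i j. if i = j then 4 * (1 / (1 + (norm u)\<^sup>2))\<^sup>2 else 0)"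
proof -
  define c where "c = 1 / (1 + (norm u)\<^sup>2)"
  have p: "1 + u \<bullet> u \<noteq> 0" by (smt (verit) inner_ge_zero)
  have c: "c * (1 + u \<bullet> u) = 1" using p by (simp add: c_def power2_norm_eq_inner)
  have D: "frechet_derivative stereo (at u) = (\<lambda>h. ((2 * c) *\<^sub>R h - (4 * c\<^sup>2 * (u \<bullet> h)) *\<^sub>R u, 4 * c\<^sup>2 * (u \<bullet> h)))"
    using frechet_derivative_at[OF stereo_has_derivative[of u]] by (simp add: c_def)
  have "frechet_derivative stereo (at u) h \<bullet> frechet_derivative stereo (at u) k = 4 * c\<^sup>2 * (h \<bullet> k)" for h k
  proof -
    have "frechet_derivative stereo (at u) h \<bullet> frechet_derivative stereo (at u) k
        = 4 * c\<^sup>2 * (h \<bullet> k) - 16 * c ^ 3 * (u \<bullet> h) * (u \<bullet> k) + 16 * c ^ 4 * (u \<bullet> h) * (u \<bullet> k) * (1 + u \<bullet> u)"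
      unfolding D inner_Pair inner_diff_left inner_diff_right inner_scaleR_left inner_scaleR_right
        inner_real_def inner_commute[of h u]
      by (simp add: power2_eq_square power3_eq_cube power4_eq_xxxx algebra_simps)
    also have "16 * c ^ 4 * (u \<bullet> h) * (u \<bullet> k) * (1 + u \<bullet> u) = 16 * c ^ 3 * (u \<bullet> h) * (u \<bullet> k)"
    proof -
      have "16 * c ^ 4 * (u \<bullet> h) * (u \<bullet> k) * (1 + u \<bullet> u) = 16 * c ^ 3 * (u \<bullet> h) * (u \<bullet> k) * (c * (1 + u \<bullet> u))"
        by (simp add: power4_eq_xxxx power3_eq_cube)
      then show ?thesis unfolding c by simp
    qed
    finally show ?thesis by simp
  qed
  then show ?thesis
    by (simp add: stereo_metric_def vec_eq_iff inner_axis_axis c_def)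
qed

lemma sqrt_det_stereo_metric:
  fixes u :: "real ^ 'n::finite"
  shows "sqrt (det (stereo_metric u)) = (2 / (1 + (norm u)\<^sup>2)) ^ CARD('n)"
proof -
  define q where "q = 2 / (1 + (norm u)\<^sup>2)"
  have q: "q \<ge> 0" by (simp add: q_def)
  have "4 * (1 / (1 + (norm u)\<^sup>2))\<^sup>2 = q\<^sup>2" by (simp add: q_def power_divide)
  then have "stereo_metric u = (\<chi> i j. if i = j then q\<^sup>2 else 0)"
    by (simp only: stereo_metric_eq)
  then have "det (stereo_metric u) = (q\<^sup>2) ^ CARD('n)"
    by (simp add: det_diagonal)
  also have "sqrt \<dots> = q ^ CARD('n)" using q by (simp add: real_sqrt_power)
  finally show ?thesis by (simp add: q_def)
qed

text \<open>Between 0 and 1 the integrand is n times t to the power n/2 - 1 times 1 - t to the power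
  n/2, a Beta density up to normalization.\<close>

lemma nn_integral_Beta:
  assumes n: "n \<ge> 1"
  shows "(\<integral>\<^sup>+t. ennreal (real n * t ^ (n - 1) * sqrt (1 / t - 1) ^ n * indicator {0<..1} t) \<partial>lborel)
     = ennreal (real n * Beta (real n / 2) (real n / 2 + 1))"
proof -
  have "((\<lambda>t. real n * (t powr (real n / 2 - 1) * (1 - t) powr (real n / 2 + 1 - 1))) has_integral
          real n * Beta (real n / 2) (real n / 2 + 1)) {0..1}"
    using n by (intro has_integral_mult_right has_integral_Beta_real) auto
  then have I: "((\<lambda>t. real n * (t powr (real n / 2 - 1) * (1 - t) powr (real n / 2))) has_integral
          real n * Beta (real n / 2) (real n / 2 + 1)) {0..1}" by simp
  have "ennreal (real n * Beta (real n / 2) (real n / 2 + 1)) =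
     (\<integral>\<^sup>+t. indicator {0..1} t * ennreal (real n * (t powr (real n / 2 - 1) * (1 - t) powr (real n / 2))) \<partial>lborel)"
    using nn_integral_has_integral_lebesgue[OF _ I] by (simp add: mult_ac ennreal_mult' ennreal_indicator)
  also have "\<dots> = (\<integral>\<^sup>+t. ennreal (real n * t ^ (n - 1) * sqrt (1 / t - 1) ^ n * indicator {0<..1} t) \<partial>lborel)"
  proof (intro nn_integral_cong_AE AE_I[of _ _ "{0, 1}"] subsetI)
    fix t assume "t \<in> {t \<in> space lborel. \<not> indicator {0..1} t * ennreal (real n * (t powr (real n / 2 - 1) * (1 - t) powr (real n / 2)))
        = ennreal (real n * t ^ (n - 1) * sqrt (1 / t - 1) ^ n * indicator {0<..1} t)}"
    moreover have "t ^ (n - 1) * sqrt (1 / t - 1) ^ n = t powr (real n / 2 - 1) * (1 - t) powr (real n / 2)"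
      if t: "0 < t" "t < 1"
    proof -
      have "sqrt (1 / t - 1) = ((1 - t) / t) powr (1 / 2)" using t by (simp add: powr_half_sqrt diff_divide_distrib)
      also have "\<dots> ^ n = ((1 - t) / t) powr (real n / 2)" using t by (simp add: powr_power)
      also have "\<dots> = (1 - t) powr (real n / 2) / t powr (real n / 2)" using t by (simp add: powr_divide)
      finally have 1: "sqrt (1 / t - 1) ^ n = (1 - t) powr (real n / 2) / t powr (real n / 2)" .
      have "t ^ (n - 1) = t powr (real n - 1)" using t n by (simp add: powr_realpow[symmetric] of_nat_diff)
      also have "\<dots> = t powr (real n / 2 - 1) * t powr (real n / 2)" using t by (simp flip: powr_add)
      finally show ?thesis using t 1 by simp
    qed
    ultimately show "t \<in> {0, 1}" by (cases "0 < t \<and> t < 1") (auto simp: indicator_def mult.assoc split: if_splits)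
  qed (auto simp: emeasure_lborel_countable)
  finally show ?thesis by simp
qed

text \<open>Layer-cake formula instead of polar coordinates: the n-th power of a is the integral of
  n t^(n - 1) from 0 to a, and after exchanging the integrals the superlevel set at height t is a
  ball of radius \<open>sqrt (1 / t - 1)\<close>.\<close>

lemma nn_integral_stereo_density:
  assumes n: "n = CARD('n::finite)"
  shows "(\<integral>\<^sup>+u. ennreal ((1 / (1 + (norm (u :: real ^ 'n))\<^sup>2)) ^ n) \<partial>lborel)
    = ennreal (unit_ball_vol n * (real n * Beta (real n / 2) (real n / 2 + 1)))"
proof -
  have n1: "n \<ge> 1" using n by (simp add: Suc_leI)
  let ?a = "\<lambda>u::real^'n. 1 / (1 + (norm u)\<^sup>2)"
  have a0: "?a u > 0" for u by (simp add: add_pos_nonneg)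
  have layer: "ennreal ((?a u) ^ n) = (\<integral>\<^sup>+t. ennreal (real n * t ^ (n - 1)) * indicator {0..?a u} t \<partial>lborel)" for u
    using n1 a0[of u] by (subst nn_integral_FTC_Icc[where F="\<lambda>t. t ^ n"])
      (auto intro!: derivative_eq_intros simp: zero_power less_imp_le)
  have "(\<integral>\<^sup>+u. ennreal ((?a u) ^ n) \<partial>lborel)
      = (\<integral>\<^sup>+u. (\<integral>\<^sup>+t. ennreal (real n * t ^ (n - 1)) * indicator {x. 0 \<le> fst x \<and> fst x \<le> ?a (snd x)} (t, u) \<partial>lborel) \<partial>lborel)"
    unfolding layer by (intro nn_integral_cong) (auto simp: indicator_def)
  also have "\<dots> = (\<integral>\<^sup>+t. (\<integral>\<^sup>+u. ennreal (real n * t ^ (n - 1)) * indicator {x. 0 \<le> fst x \<and> fst x \<le> ?a (snd x)} (t, u) \<partial>lborel) \<partial>lborel)"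
    by (rule lborel_pair.Fubini') measurable
  also have "\<dots> = (\<integral>\<^sup>+t. ennreal (unit_ball_vol n) * ennreal (real n * t ^ (n - 1) * sqrt (1 / t - 1) ^ n * indicator {0<..1} t) \<partial>lborel)"
  \<comment> \<open>At \<open>t = 0\<close> the superlevel set is the whole space, of infinite
    measure, so the equality is claimed off this null set only.\<close>
  proof (intro nn_integral_cong_AE AE_I[of _ _ "{0}"] subsetI)
    fix t :: real
    assume t: "t \<in> {t \<in> space lborel. \<not> (\<integral>\<^sup>+u. ennreal (real n * t ^ (n - 1)) * indicator {x. 0 \<le> fst x \<and> fst x \<le> ?a (snd x)} (t, u) \<partial>lborel)
       = ennreal (unit_ball_vol n) * ennreal (real n * t ^ (n - 1) * sqrt (1 / t - 1) ^ n * indicator {0<..1} t)}"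
    show "t \<in> {0}"
    proof (rule ccontr)
      assume "t \<notin> {0}"
      then consider "t < 0" | "t > 1" | "0 < t" "t \<le> 1" by fastforce
      then have "(\<integral>\<^sup>+u. ennreal (real n * t ^ (n - 1)) * indicator {x. 0 \<le> fst x \<and> fst x \<le> ?a (snd x)} (t, u) \<partial>lborel)
       = ennreal (unit_ball_vol n) * ennreal (real n * t ^ (n - 1) * sqrt (1 / t - 1) ^ n * indicator {0<..1} t)"
      proof cases
        case 1
        then show ?thesis by (simp add: indicator_def)
      next
        case 2
        have "\<not> t \<le> ?a u" for u
        proof -
          have "?a u \<le> 1" by (simp add: divide_le_eq_1_pos add_pos_nonneg)
          then show ?thesis using 2 by linarith
        qed
        then show ?thesis using 2 by (simp add: indicator_def)
      next
        case 3
        have "t \<le> ?a u \<longleftrightarrow> norm u \<le> sqrt (1 / t - 1)" for u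
        proof -
          have "t \<le> ?a u \<longleftrightarrow> (norm u)\<^sup>2 \<le> 1 / t - 1"
            using 3 by (simp add: divide_simps add_pos_nonneg) (simp add: algebra_simps)
          also have "\<dots> \<longleftrightarrow> norm u \<le> sqrt (1 / t - 1)"
            using real_le_rsqrt[of "norm u" "1 / t - 1"] real_sqrt_le_iff[of "(norm u)\<^sup>2" "1 / t - 1"] by auto
          finally show ?thesis .
        qed
        then have ind: "indicator {x. 0 \<le> fst x \<and> fst x \<le> ?a (snd x)} (t, u) = (indicator (cball 0 (sqrt (1 / t - 1))) u :: ennreal)" for u
          using 3 by (simp add: indicator_def)
        have "(\<integral>\<^sup>+u. ennreal (real n * t ^ (n - 1)) * indicator {x. 0 \<le> fst x \<and> fst x \<le> ?a (snd x)} (t, u) \<partial>lborel)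
          = ennreal (real n * t ^ (n - 1)) * emeasure lborel (cball (0 :: real ^ 'n) (sqrt (1 / t - 1)))"
          unfolding ind by (rule nn_integral_cmult_indicator) simp
        also have "\<dots> = ennreal (real n * t ^ (n - 1)) * ennreal (unit_ball_vol n * sqrt (1 / t - 1) ^ n)"
          using 3 n by (subst emeasure_cball) auto
        finally show ?thesis using 3 by (simp add: ennreal_mult'[symmetric] mult_ac flip: ennreal_mult)
      qed
      then show False using t by simp
    qed
  qed auto
  also have "\<dots> = ennreal (unit_ball_vol n) * ennreal (real n * Beta (real n / 2) (real n / 2 + 1))"
    unfolding nn_integral_Beta[OF n1, symmetric] by (rule nn_integral_cmult) measurable
  also have "\<dots> = ennreal (unit_ball_vol n * (real n * Beta (real n / 2) (real n / 2 + 1)))"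
    by (simp add: ennreal_mult')
  finally show ?thesis .
qed

lemma sphere_volume_eq:
  assumes n: "n = CARD('n::finite)"
  shows "sphere_volume TYPE('n) = 2 ^ n * unit_ball_vol n * real n * Beta (real n / 2) (real n / 2 + 1)"
proof -
  have B: "Beta (real n / 2) (real n / 2 + 1) \<ge> 0"
    using n by (auto simp: Beta_def intro!: divide_nonneg_nonneg mult_nonneg_nonneg Gamma_real_nonneg)
  have "sphere_volume TYPE('n) = (\<integral>u. 2 ^ n * (1 / (1 + (norm (u :: real ^ 'n))\<^sup>2)) ^ n \<partial>lborel)"
    unfolding sphere_volume_def sqrt_det_stereo_metric n by (simp add: power_divide)
  also have "\<dots> = 2 ^ n * (\<integral>u. (1 / (1 + (norm (u :: real ^ 'n))\<^sup>2)) ^ n \<partial>lborel)"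
    by (rule integral_mult_right_zero)
  also have "(\<integral>u. (1 / (1 + (norm (u :: real ^ 'n))\<^sup>2)) ^ n \<partial>lborel) = unit_ball_vol n * (real n * Beta (real n / 2) (real n / 2 + 1))"
    using B by (subst integral_eq_nn_integral) (auto simp: nn_integral_stereo_density[OF n] add_nonneg_nonneg)
  finally show ?thesis by simp
qed

text \<open>The unit ball volume enters once directly and once through \<open>sphere_volume\<close>,
  so the powers of \<open>pi\<close> cancel those in the denominator. The arguments of Beta add up
  to n + 1, whose Gamma value is the factorial of n.\<close>

lemma weyl_eq:
  assumes n: "n = CARD('n::finite)"
  shows "weyl TYPE('n) x = 2 / fact n * x powr (real n / 2)"
proof -
  have n0: "real n / 2 > 0" using n by simp
  define G where "G = Gamma (real n / 2)"
  have G: "G > 0" using n0 by (simp add: G_def Gamma_real_pos)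
  have G1: "Gamma (real n / 2 + 1) = real n / 2 * G"
    using n0 by (subst Gamma_plus1) (auto simp: G_def nonpos_Ints_def)
  have G2: "Gamma (real n / 2 + (real n / 2 + 1)) = fact n"
    using Gamma_fact[of n] by (simp add: add.commute)
  have V: "unit_ball_vol n = pi powr (real n / 2) / (real n / 2 * G)"
    by (simp add: unit_ball_vol_def G1)
  have pp: "pi powr (real n / 2) * pi powr (real n / 2) = pi ^ n"
    by (simp add: powr_realpow flip: powr_add)
  have "unit_ball_vol n / (2 * pi) ^ n * (2 ^ n * unit_ball_vol n * real n * Beta (real n / 2) (real n / 2 + 1))
    = (pi powr (real n / 2) * pi powr (real n / 2)) * 2 ^ n * real n * G / ((real n / 2 * G) * (2 * pi) ^ n * fact n)"
    unfolding V Beta_def G1 G2 G_def[symmetric] using n0 G by (simp add: divide_simps)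
  also have "\<dots> = 2 / fact n"
    unfolding pp using n0 G by (simp add: power_mult_distrib)
  finally have "unit_ball_vol n / (2 * pi) ^ n * sphere_volume TYPE('n) = 2 / fact n"
    by (simp add: sphere_volume_eq[OF n])
  moreover have "measure lborel (ball (0 :: real ^ 'n) 1) = unit_ball_vol n"
    using content_ball[of 1 "0 :: real ^ 'n"] n by simp
  ultimately show ?thesis by (simp add: weyl_def n)
qed

section \<open>Crossings\<close>

text \<open>Pairs each factor with its mirror image. The factors of a pair have a sum independent of
  \<open>j\<close>, so every pair can be compared with the same \<open>x\<close>.\<close>

lemma pochhammer_power2:
  fixes a :: real
  shows "(pochhammer a m)\<^sup>2 = (\<Prod>j<m. (a + real j) * (a + real (m - Suc j)))"
proof -
  have 1: "pochhammer a m = (\<Prod>j<m. a + real j)"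
    by (simp add: pochhammer_prod atLeast0LessThan)
  also have "\<dots> = (\<Prod>j<m. a + real (m - Suc j))"
    by (rule prod.nat_diff_reindex[symmetric])
  finally show ?thesis using 1 by (simp add: power2_eq_square prod.distrib)
qed

lemma powr_half_power2: "x > 0 \<Longrightarrow> (x powr (real n / 2))\<^sup>2 = x ^ n"
  by (simp add: powr_power powr_realpow)

text \<open>Squares are compared. With x = K (K + n - 1), each pair of factors exceeds x by K + (1 +
  j) (n - 1 - j), and the square of 2 K + n exceeds 4 x by 4 K + n^2.\<close>

lemma weyl_less_counting:
  assumes n: "n = CARD('n::finite)" and K: "K \<ge> 1"
  shows "weyl TYPE('n) (sphere_lambda n K) < sphere_counting TYPE('n) (sphere_lambda n K)"
proof -
  have n1: "n \<ge> 1" using n by (simp add: Suc_leI)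
  define x where "x = sphere_lambda n K"
  define P where "P = pochhammer (real K + 1) (n - 1)"
  have x: "x > 0" using K n1 by (simp add: x_def sphere_lambda_def)
  have P: "P \<ge> 0" unfolding P_def by (intro pochhammer_nonneg) simp
  have fac: "x \<le> (real K + 1 + real j) * (real K + 1 + real (n - 1 - Suc j))" if "j < n - 1" for j
  proof -
    have r: "real (n - 1 - Suc j) = real n - 2 - real j" using that by (simp add: of_nat_diff)
    have "(1 + real j) * (real n - 1 - real j) \<ge> 0" using that by (intro mult_nonneg_nonneg) auto
    then show ?thesis unfolding r x_def sphere_lambda_def by (simp add: algebra_simps)
  qed
  have "x ^ (n - 1) = (\<Prod>j<n - 1. x)" by simp
  also have "\<dots> \<le> P\<^sup>2"
    unfolding P_def pochhammer_power2 using x fac by (intro prod_mono) auto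
  finally have P2: "x ^ (n - 1) \<le> P\<^sup>2" .
  have xn: "x * x ^ (n - 1) = x ^ n" using n1 by (metis Suc_diff_1 Suc_le_eq One_nat_def power_Suc)
  have lead: "4 * x < (2 * real K + real n)\<^sup>2"
    using K n1 by (simp add: x_def sphere_lambda_def power2_eq_square algebra_simps add_pos_pos)
  have "(2 * x powr (real n / 2))\<^sup>2 = 4 * x * x ^ (n - 1)"
    by (simp only: power_mult_distrib powr_half_power2[OF x] xn mult.assoc) simp
  also have "\<dots> < (2 * real K + real n)\<^sup>2 * x ^ (n - 1)"
    using lead x by (intro mult_strict_right_mono) auto
  also have "\<dots> \<le> (2 * real K + real n)\<^sup>2 * P\<^sup>2"
    using P2 by (intro mult_left_mono) auto
  finally have "(2 * x powr (real n / 2))\<^sup>2 < ((2 * real K + real n) * P)\<^sup>2" by (simp add: power_mult_distrib)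
  then have "2 * x powr (real n / 2) < (2 * real K + real n) * P"
    by (rule power2_less_imp_less) (use P in simp)
  moreover have "sphere_counting TYPE('n) x = (2 * real K + real n) * P / fact n"
    unfolding P_def x_def by (rule sphere_counting_between[OF n])
      (use strict_mono_sphere_lambda[OF n1] in \<open>auto simp: strict_mono_less\<close>)
  ultimately show ?thesis
    unfolding x_def[symmetric] by (simp add: weyl_eq[OF n] divide_strict_right_mono)
qed

text \<open>The mirror image of \<open>weyl_less_counting\<close>. Now x exceeds each pair of
  factors by K + 1/2 - j (n - 2 - j), and 4 x exceeds the square of 2 K + n by 4 K + 4 n - 2 - n^2;
  both are positive once K is at least n^2. The offset 1/2 stays within the gap 2 K + n to the
  previous eigenvalue.\<close>

lemma counting_less_weyl:
  assumes n: "n = CARD('n::finite)" and K: "K \<ge> n\<^sup>2"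
  defines "x \<equiv> sphere_lambda n (Suc K) - 1 / 2"
  shows "sphere_counting TYPE('n) x < weyl TYPE('n) x"
proof -
  have n1: "n \<ge> 1" using n by (simp add: Suc_leI)
  have K': "real n * real n \<le> real K" using K by (metis of_nat_le_iff of_nat_mult power2_eq_square)
  define P where "P = pochhammer (real K + 1) (n - 1)"
  have xe: "x = (real K + 1) * (real K + real n) - 1 / 2" by (simp add: x_def sphere_lambda_def)
  have "1 * 1 \<le> (real K + 1) * (real K + real n)" using n1 by (intro mult_mono) auto
  then have x: "x > 0" using xe by simp
  have P: "P \<ge> 0" unfolding P_def by (intro pochhammer_nonneg) simp
  have fac: "(real K + 1 + real j) * (real K + 1 + real (n - 1 - Suc j)) \<le> x" if "j < n - 1" for j
  proof -
    have r: "real (n - 1 - Suc j) = real n - 2 - real j" using that by (simp add: of_nat_diff)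
    have "real j * (real n - 2 - real j) \<le> real n * real n" using that by (intro mult_mono) auto
    then show ?thesis using K' unfolding r xe by (simp add: algebra_simps)
  qed
  have "P\<^sup>2 \<le> (\<Prod>j<n - 1. x)"
    unfolding P_def pochhammer_power2 using fac by (intro prod_mono) auto
  then have P2: "P\<^sup>2 \<le> x ^ (n - 1)" by simp
  have xn: "x * x ^ (n - 1) = x ^ n" using n1 by (metis Suc_diff_1 Suc_le_eq One_nat_def power_Suc)
  have lead: "(2 * real K + real n)\<^sup>2 < 4 * x"
  proof -
    have "real n \<ge> 1" using n1 by simp
    then show ?thesis using K' unfolding xe by (simp add: power2_eq_square algebra_simps)
  qed
  have "((2 * real K + real n) * P)\<^sup>2 \<le> (2 * real K + real n)\<^sup>2 * x ^ (n - 1)"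
    unfolding power_mult_distrib using P2 by (intro mult_left_mono) auto
  also have "\<dots> < 4 * x * x ^ (n - 1)"
    using lead x by (intro mult_strict_right_mono) auto
  also have "\<dots> = (2 * x powr (real n / 2))\<^sup>2"
    by (simp only: power_mult_distrib powr_half_power2[OF x] xn mult.assoc) simp
  finally have "(2 * real K + real n) * P < 2 * x powr (real n / 2)"
    by (rule power2_less_imp_less) simp
  moreover have "sphere_counting TYPE('n) x = (2 * real K + real n) * P / fact n"
    unfolding P_def
  proof (rule sphere_counting_between[OF n])
    have "sphere_lambda n (Suc K) - sphere_lambda n K = 2 * real K + real n"
      by (simp add: sphere_lambda_def algebra_simps)
    then show "sphere_lambda n K \<le> x" using n1 unfolding x_def by simp
  qed (simp add: x_def)
  ultimately show ?thesis by (simp add: weyl_eq[OF n] divide_strict_right_mono)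
qed

theorem mainTheorem1:
  fixes n :: nat
  assumes "n \<ge> 1" and "CARD('n::finite) = n"
  shows "crosses_infinitely_often (sphere_counting TYPE('n)) (weyl TYPE('n))
    \<and> \<not> (\<forall>x>0. sphere_counting TYPE('n) x < weyl TYPE('n) x)
    \<and> \<not> (\<forall>x>0. sphere_counting TYPE('n) x > weyl TYPE('n) x)"
proof -
  let ?N = "sphere_counting TYPE('n)" and ?w = "weyl TYPE('n)"
  have n: "n = CARD('n)" using assms(2) by simp
  \<comment> \<open>Even indices lie just below an eigenvalue, and the following odd index is at
    that eigenvalue. Starting at \<open>n\<^sup>2\<close> makes \<open>counting_less_weyl\<close>
    applicable, and eigenvalue gaps of at least 1 exceed the offset 1/2, so the sequence
    increases.\<close>
  define x where "x i = sphere_lambda n (Suc (n\<^sup>2 + i div 2)) - (if even i then 1 / 2 else 0)" for i :: nat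
  have even: "?N (x i) - ?w (x i) < 0" if "even i" for i
    using counting_less_weyl[OF n, of "n\<^sup>2 + i div 2"] that by (simp add: x_def)
  have odd: "?N (x i) - ?w (x i) > 0" if "odd i" for i
    using weyl_less_counting[OF n, of "Suc (n\<^sup>2 + i div 2)"] that by (simp add: x_def)
  have mono: "strict_mono x"
  proof (rule strict_monoI_Suc)
    fix i
    have "sphere_lambda n (Suc k) - sphere_lambda n k \<ge> 1" for k
      using assms(1) by (simp add: sphere_lambda_def algebra_simps)
    from this[of "Suc (n\<^sup>2 + i div 2)"] show "x i < x (Suc i)"
      by (cases "even i") (auto simp: x_def elim!: oddE)
  qed
  have ge: "real i / 2 \<le> x i" for i
  proof -
    have "real k \<le> sphere_lambda n k" if "k \<ge> 1" for k
    proof -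
      have "real k * 1 \<le> real k * (real k + real n - 1)" using assms(1) that by (intro mult_left_mono) auto
      then show ?thesis by (simp add: sphere_lambda_def)
    qed
    from this[of "Suc (n\<^sup>2 + i div 2)"] have "real (Suc (n\<^sup>2 + i div 2)) - 1 / 2 \<le> x i"
      by (auto simp: x_def)
    moreover have "real i \<le> 2 * real (i div 2) + 1"
    proof -
      have "real i \<le> real (2 * (i div 2) + 1)" by (simp only: of_nat_le_iff)
      then show ?thesis by (simp only: of_nat_add of_nat_mult of_nat_numeral of_nat_1)
    qed
    ultimately show ?thesis using zero_le_power2[of "real n"] unfolding of_nat_Suc of_nat_add of_nat_power by linarith
  qed
  have lim: "filterlim x at_top sequentially"
    unfolding filterlim_at_top
  proof
    fix Z :: real
    show "\<forall>\<^sub>F i in sequentially. Z \<le> x i"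
    proof (rule eventually_sequentiallyI)
      fix i assume "nat \<lceil>2 * Z\<rceil> \<le> i"
      then have "2 * Z \<le> real i" by linarith
      then show "Z \<le> x i" using ge[of i] by simp
    qed
  qed
  have "x 0 < x 1" using mono by (simp add: strict_mono_less)
  have x0: "x 0 > 0"
  proof -
    have "1 * 1 \<le> real (Suc (n\<^sup>2)) * (real (Suc (n\<^sup>2)) + real n - 1)"
      using assms(1) by (intro mult_mono) (auto intro!: add_increasing)
    then show ?thesis by (simp add: x_def sphere_lambda_def)
  qed
  have "?N (x i) - ?w (x i) \<noteq> 0 \<and> sgn (?N (x (Suc i)) - ?w (x (Suc i))) = - sgn (?N (x i) - ?w (x i))" for i
    using even[of i] odd[of i] even[of "Suc i"] odd[of "Suc i"] by (cases "even i") auto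
  then have "crosses_infinitely_often ?N ?w"
    unfolding crosses_infinitely_often_def using x0 mono lim by blast
  moreover have "\<not> (\<forall>x>0. ?N x < ?w x)"
    using odd[of 1] x0 \<open>x 0 < x 1\<close> by (metis diff_gt_0_iff_gt less_trans not_less_iff_gr_or_eq odd_one)
  moreover have "\<not> (\<forall>x>0. ?N x > ?w x)"
    using even[of 0] x0 by (metis diff_less_0_iff_less even_zero not_less_iff_gr_or_eq)
  ultimately show ?thesis by blast
qed

end
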